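(* Let $\alpha\in(-\frac12,0)$. Then the Painlevé-II equation $$y''(s)-sy(s)-2y^3(s)-\alpha=0,\quad s\in\mathbb{R},$$ admits a solution $Y_-$, defined on all of $\mathbb{R}$, which changes sign exactly once and is energy minimizing with respect to compactly supported perturbations. Moreover, $Y_-$ satisfies $$Y_-(s)=-\sqrt{-\frac{s}{2}}+O\left(\frac1s\right)\ \text{as } s\to-\infty,\qquad Y_-(s)\sim\frac{|\alpha|}{s}\ \text{as } s\to+\infty.$$
   Context: A solution $y:\mathbb{R}\to\mathbb{R}$ of $y''-sy-2y^3-\alpha=0$ is energy minimizing with respect to compactly supported perturbations (minimal in the sense of Morse / De Giorgi) if, for every $\phi\in C_0^\infty(\mathbb{R})$, $$\int_{\mathrm{supp}\,\phi}\left\{\tfrac12(y')^2+\tfrac12sy^2+\tfrac12y^4+\alpha y\right\}ds\le\int_{\mathrm{supp}\,\phi}\left\{\tfrac12(y'+\phi')^2+\tfrac12s(y+\phi)^2+\tfrac12(y+\phi)^4+\alpha(y+\phi)\right\}ds.$$ The notation $g(s)\sim h(s)$ means $g(s)/h(s)\to1$. *)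

theory Defs
  imports "HOL-Analysis.Analysis" "HOL-Library.Landau_Symbols"
begin

definition painleve2_solution :: "real \<Rightarrow> (real \<Rightarrow> real) \<Rightarrow> bool" where
  "painleve2_solution \<alpha> y \<longleftrightarrow>
     (\<forall>s. y differentiable (at s)) \<and> (\<forall>s. deriv y differentiable (at s)) \<and>
     (\<forall>s. deriv (deriv y) s - s * y s - 2 * y s ^ 3 - \<alpha> = 0)"

definition supp :: "(real \<Rightarrow> real) \<Rightarrow> real set" where
  "supp \<phi> = closure {s. \<phi> s \<noteq> 0}"

definition test_function :: "(real \<Rightarrow> real) \<Rightarrow> bool" where
  "test_function \<phi> \<longleftrightarrow>
     (\<forall>n s. (deriv ^^ n) \<phi> differentiable (at s)) \<and> compact (supp \<phi>)"

definition painleve2_energy :: "real \<Rightarrow> real set \<Rightarrow> (real \<Rightarrow> real) \<Rightarrow> real" where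
  "painleve2_energy \<alpha> A u =
     (LINT s:A|lborel. 1/2 * (deriv u s)\<^sup>2 + 1/2 * s * (u s)\<^sup>2 + 1/2 * u s ^ 4 + \<alpha> * u s)"

(* Meant for continuously differentiable y: both integrands are then continuous on the
   compact set supp phi, so the Lebesgue integrals below genuinely exist. Solutions of
   the equation are continuously differentiable. *)
definition energy_minimizing :: "real \<Rightarrow> (real \<Rightarrow> real) \<Rightarrow> bool" where
  "energy_minimizing \<alpha> y \<longleftrightarrow>
     (\<forall>\<phi>. test_function \<phi> \<longrightarrow>
        painleve2_energy \<alpha> (supp \<phi>) y \<le> painleve2_energy \<alpha> (supp \<phi>) (\<lambda>s. y s + \<phi> s))"

(* One strict sign on each side of a single point; in particular y does not touch zero
   anywhere else, and y s0 = 0 if y is continuous. *)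
definition changes_sign_exactly_once :: "(real \<Rightarrow> real) \<Rightarrow> bool" where
  "changes_sign_exactly_once y \<longleftrightarrow>
     (\<exists>s0. ((\<forall>s<s0. y s < 0) \<and> (\<forall>s>s0. y s > 0)) \<or>
           ((\<forall>s<s0. y s > 0) \<and> (\<forall>s>s0. y s < 0)))"

end

theory Submission
  imports Defs
begin

text \<open>
  Put \<open>p = Y' + Y\<^sup>2 + s/2\<close> for a solution \<open>Y\<close>, so that \<open>p' = 2 Y p + (\<alpha> + 1/2)\<close>. Completing the
  square, the energy density of \<open>Y + \<phi>\<close> exceeds that of \<open>Y\<close> by
  \<open>p \<phi>\<^sup>2 + (\<phi>' + 2 Y \<phi> + \<phi>\<^sup>2)\<^sup>2 / 2\<close> plus the derivative of a compactly supported function. Hence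
  \<open>p \<ge> 0\<close> implies minimality. It also makes \<open>Y\<close> strictly increasing at its zeros in \<open>s < 0\<close>, while a
  non-increasing zero in \<open>s \<ge> 0\<close> would force \<open>Y \<rightarrow> -\<infinity>\<close>. Since \<open>\<alpha> + 1/2 > 0\<close>, a negative value of \<open>p\<close> would
  grow exponentially towards \<open>-\<infinity>\<close>, which is incompatible with \<open>Y \<sim> -\<surd>(-s/2)\<close> there.

  A solution with the right behaviour is trapped between a sub- and a supersolution. The positive
  root \<open>g\<close> of \<open>2 g\<^sup>3 + s g = 2\<close> is a supersolution and \<open>-g\<close> a subsolution, so there is a solution \<open>u\<close> with
  \<open>0 \<le> u \<le> g\<close>. With \<open>b = \<surd>(-s/2)\<close>, the function \<open>v = b tanh (C - 4 b\<^sup>3/3) + 1/(8 b\<^sup>2)\<close>, an approximate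
  solution of \<open>y' + y\<^sup>2 + s/2 = 0\<close>, is a supersolution near \<open>-\<infinity>\<close>, where it is asymptotic to \<open>-b\<close>.
  Because \<open>|\<alpha>| < 1/2\<close>, \<open>u\<close> drops below \<open>b + 1/(8 b\<^sup>2)\<close> somewhere, so for large \<open>C\<close> the graph of \<open>v\<close> crosses
  that of \<open>u\<close>, and \<open>min v u\<close> continued by \<open>u\<close> is a global supersolution above \<open>-g\<close>.
\<close>

section \<open>Second-order equations: a linear boundary value problem and limits of solutions\<close>

text \<open>Variation of constants with the fundamental system \<open>exp (k * x)\<close>,
  \<open>exp (- k * x)\<close> gives a particular solution \<open>v\<close> with
  \<open>v a = 0\<close>; the \<open>cosh\<close> and \<open>sinh\<close> terms then fit the
  boundary values. This supplies one step of the monotone iteration below.\<close>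

lemma bounded_linear_bvp:
  fixes h :: "real \<Rightarrow> real" and k a b A B :: real
  assumes k: "k > 0" and ab: "a < b" and h: "continuous_on {a..b} h"
  obtains u u' where
    "\<And>x. x \<in> {a..b} \<Longrightarrow> (u has_real_derivative u' x) (at x within {a..b})"
    "\<And>x. x \<in> {a..b} \<Longrightarrow> (u' has_real_derivative k\<^sup>2 * u x + h x) (at x within {a..b})"
    "u a = A" "u b = B"
proof -
  define P where "P = (\<lambda>x. integral {a..x} (\<lambda>t. exp (- k * t) * h t))"
  define Q where "Q = (\<lambda>x. integral {a..x} (\<lambda>t. exp (k * t) * h t))"
  have P: "(P has_real_derivative exp (- k * x) * h x) (at x within {a..b})" if "x \<in> {a..b}" for x
    unfolding P_def by (rule integral_has_real_derivative[OF _ that]) (intro continuous_intros h)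
  have Q: "(Q has_real_derivative exp (k * x) * h x) (at x within {a..b})" if "x \<in> {a..b}" for x
    unfolding Q_def by (rule integral_has_real_derivative[OF _ that]) (intro continuous_intros h)
  define v where "v = (\<lambda>x. (exp (k * x) * P x - exp (- k * x) * Q x) / (2 * k))"
  define v' where "v' = (\<lambda>x. (exp (k * x) * P x + exp (- k * x) * Q x) / 2)"
  \<comment> \<open>The boundary condition at \<open>b\<close> solved for the coefficient of
    \<open>sinh\<close>; the denominator is nonzero because \<open>k > 0\<close> and
    \<open>a < b\<close>.\<close>
  define D where "D = (B - v b - A * cosh (k * (b - a))) / sinh (k * (b - a))"
  define u where "u = (\<lambda>x. v x + A * cosh (k * (x - a)) + D * sinh (k * (x - a)))"
  define u' where "u' = (\<lambda>x. v' x + k * A * sinh (k * (x - a)) + k * D * cosh (k * (x - a)))"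
  have ee: "exp (k * x) * exp (- (k * x)) = 1" for x
    by (simp add: exp_minus)
  have ee': "exp (k * x) * (exp (- (k * x)) * z) = z" "exp (- (k * x)) * (exp (k * x) * z) = z" for x z
    by (simp_all add: exp_minus)
  have v: "(v has_real_derivative v' x) (at x within {a..b})" if x: "x \<in> {a..b}" for x
    unfolding v_def using k
    by (auto intro!: derivative_eq_intros P[OF x] Q[OF x]
        simp: v'_def field_simps ee')
  have v': "(v' has_real_derivative k\<^sup>2 * v x + h x) (at x within {a..b})" if x: "x \<in> {a..b}" for x
    unfolding v'_def using k
    by (auto intro!: derivative_eq_intros P[OF x] Q[OF x]
        simp: v_def field_simps power2_eq_square ee ee')
  show ?thesis
  proof
    fix x assume x: "x \<in> {a..b}"
    show "(u has_real_derivative u' x) (at x within {a..b})"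
      unfolding u_def
      by (auto intro!: derivative_eq_intros v[OF x] simp: u'_def algebra_simps)
    show "(u' has_real_derivative k\<^sup>2 * u x + h x) (at x within {a..b})"
      unfolding u'_def
      by (auto intro!: derivative_eq_intros v'[OF x] simp: u_def algebra_simps power2_eq_square)
  next
    show "u a = A" by (simp add: u_def v_def P_def Q_def)
    have "sinh (k * (b - a)) \<noteq> 0" using k ab by simp
    then show "u b = B" by (simp add: u_def D_def)
  qed
qed

text \<open>Integrating twice turns the equation into an identity that survives dominated
  convergence. Convergence of the slopes \<open>y' n a\<close> is not assumed; it is recovered from
  the values at the two endpoints.\<close>

lemma second_derivative_limit:
  fixes y y' h :: "nat \<Rightarrow> real \<Rightarrow> real" and Y H :: "real \<Rightarrow> real"
  assumes ab: "a < b"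
    and y: "\<And>n x. x \<in> {a..b} \<Longrightarrow> (y n has_real_derivative y' n x) (at x within {a..b})"
    and y': "\<And>n x. x \<in> {a..b} \<Longrightarrow> (y' n has_real_derivative h n x) (at x within {a..b})"
    and h: "\<And>n. continuous_on {a..b} (h n)"
    and bound: "\<And>n x. x \<in> {a..b} \<Longrightarrow> \<bar>h n x\<bar> \<le> M"
    and Y: "\<And>x. x \<in> {a..b} \<Longrightarrow> (\<lambda>n. y n x) \<longlonglongrightarrow> Y x"
    and H: "\<And>x. x \<in> {a..b} \<Longrightarrow> (\<lambda>n. h n x) \<longlonglongrightarrow> H x"
    and cont: "continuous_on {a..b} Y \<Longrightarrow> continuous_on {a..b} H"
  obtains Y' where
    "\<And>x. x \<in> {a..b} \<Longrightarrow> (Y has_real_derivative Y' x) (at x within {a..b})"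
    "\<And>x. x \<in> {a..b} \<Longrightarrow> (Y' has_real_derivative H x) (at x within {a..b})"
proof -
  define I where "I = (\<lambda>n x. integral {a..x} (h n))"
  have hint: "h n integrable_on {a..x}" if "x \<in> {a..b}" for n x
    by (rule integrable_continuous_real, rule continuous_on_subset[OF h]) (use that in auto)
  have I: "y' n x = y' n a + I n x" if x: "x \<in> {a..b}" for n x
  proof -
    have "(h n has_integral (y' n x - y' n a)) {a..x}"
      using x by (intro fundamental_theorem_of_calculus)
        (auto simp flip: has_real_derivative_iff_has_vector_derivative
          intro: DERIV_subset[OF y'])
    then show ?thesis by (simp add: I_def integral_unique)
  qed
  have Hint: "H integrable_on {a..x}" and Ilim: "(\<lambda>n. I n x) \<longlonglongrightarrow> integral {a..x} H"
    if x: "x \<in> {a..b}" for x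
    using dominated_convergence[of h "{a..x}" "\<lambda>_. M" H, OF hint[OF x]] bound H x
    by (auto simp: I_def)
  have Ibound: "\<bar>I n x\<bar> \<le> M * (b - a)" if x: "x \<in> {a..b}" for n x
  proof -
    have M: "0 \<le> M" using bound[of a 0] ab by auto
    have "norm (I n x) \<le> integral {a..x} (\<lambda>_. M)"
      unfolding I_def using x bound
      by (intro integral_norm_bound_integral hint[OF x]) auto
    also have "\<dots> \<le> M * (b - a)" using x mult_left_mono[of "x - a" "b - a" M] M by (simp add: mult.commute)
    finally show ?thesis by simp
  qed
  have Icont: "continuous_on {a..b} (I n)" for n
    unfolding I_def by (rule indefinite_integral_continuous_1) (rule hint, use ab in auto)
  have y'int: "(y' n has_integral (y n x - y n a)) {a..x}" if x: "x \<in> {a..b}" for n x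
    using x by (intro fundamental_theorem_of_calculus)
      (auto simp flip: has_real_derivative_iff_has_vector_derivative
        intro: DERIV_subset[OF y])
  have Iint: "I n integrable_on {a..x}" if x: "x \<in> {a..b}" for n x
    by (rule integrable_continuous_real, rule continuous_on_subset[OF Icont]) (use that in auto)
  have eq: "y n x = y n a + y' n a * (x - a) + integral {a..x} (I n)" if x: "x \<in> {a..b}" for n x
  proof -
    have "((\<lambda>t. y' n a + I n t) has_integral (y n x - y n a)) {a..x}"
    proof (rule has_integral_eq[OF _ y'int[OF x]])
      fix t assume "t \<in> {a..x}"
      with x have "t \<in> {a..b}" by auto
      then show "y' n t = y' n a + I n t" by (rule I)
    qed
    moreover have "((\<lambda>t. y' n a + I n t) has_integral (y' n a * (x - a) + integral {a..x} (I n))) {a..x}"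
      using x has_integral_const_real[of "y' n a" a x]
      by (intro has_integral_add integrable_integral Iint[OF x]) (auto simp: mult.commute)
    ultimately have "y n x - y n a = y' n a * (x - a) + integral {a..x} (I n)"
      by (rule has_integral_unique)
    then show ?thesis by simp
  qed
  define J where "J = (\<lambda>x. integral {a..x} H)"
  have Jint: "J integrable_on {a..x}" and Jlim: "(\<lambda>n. integral {a..x} (I n)) \<longlonglongrightarrow> integral {a..x} J"
    if x: "x \<in> {a..b}" for x
    using dominated_convergence[of I "{a..x}" "\<lambda>_. M * (b - a)" J, OF Iint[OF x]] Ibound Ilim x
    by (auto simp: J_def)
  \<comment> \<open>The limit of the slopes \<open>y' n a\<close>, read off from the twice
    integrated identity at \<open>x = b\<close>.\<close>
  define c where "c = (Y b - Y a - integral {a..b} J) / (b - a)"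
  have "(\<lambda>n. (y n b - y n a - integral {a..b} (I n)) / (b - a)) \<longlonglongrightarrow> c"
    unfolding c_def using ab by (intro tendsto_intros Y Jlim) auto
  moreover have "(y n b - y n a - integral {a..b} (I n)) / (b - a) = y' n a" for n
    using eq[of b n] ab by simp
  ultimately have c: "(\<lambda>n. y' n a) \<longlonglongrightarrow> c" by simp
  have Yeq: "Y x = Y a + c * (x - a) + integral {a..x} J" if x: "x \<in> {a..b}" for x
  proof (rule LIMSEQ_unique[OF Y[OF x]])
    show "(\<lambda>n. y n x) \<longlonglongrightarrow> Y a + c * (x - a) + integral {a..x} J"
      unfolding eq[OF x] by (intro tendsto_intros Y c Jlim x) (use ab in auto)
  qed
  have Jcont: "continuous_on {a..b} J"
    unfolding J_def by (rule indefinite_integral_continuous_1) (rule Hint, use ab in auto)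
  define Y' where "Y' = (\<lambda>x. c + J x)"
  have dY: "(Y has_real_derivative Y' x) (at x within {a..b})" if x: "x \<in> {a..b}" for x
  proof -
    have "((\<lambda>x. Y a + c * (x - a) + integral {a..x} J) has_real_derivative Y' x) (at x within {a..b})"
      by (auto intro!: derivative_eq_intros integral_has_real_derivative[OF Jcont x] simp: Y'_def)
    then show ?thesis
      using has_field_derivative_transform_within[OF _ zero_less_one x] Yeq by (metis (no_types, lifting))
  qed
  \<comment> \<open>Bootstrapping: differentiability of \<open>Y\<close> makes \<open>H\<close>
    continuous through \<open>cont\<close>, and only then can the integral \<open>J\<close> of
    \<open>H\<close> be differentiated.\<close>
  then have "continuous_on {a..b} Y"
    by (rule DERIV_continuous_on)
  then have Hc: "continuous_on {a..b} H" by (rule cont)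
  have "(Y' has_real_derivative H x) (at x within {a..b})" if x: "x \<in> {a..b}" for x
    unfolding Y'_def J_def
    by (auto intro!: derivative_eq_intros integral_has_real_derivative[OF Hc x])
  with dY show thesis by (rule that)
qed

section \<open>Sub- and supersolutions in the touching sense, and the maximum principle\<close>

text \<open>Supersolutions are tested by touching functions from above, so that a minimum of
  supersolutions is again one although it is not differentiable.\<close>
definition supersolution_at :: "(real \<Rightarrow> real \<Rightarrow> real) \<Rightarrow> (real \<Rightarrow> real) \<Rightarrow> real \<Rightarrow> bool" where
  "supersolution_at F v s \<longleftrightarrow>
     (\<exists>\<psi> \<psi>' c. \<psi> s = v s \<and>
        (\<forall>\<^sub>F x in nhds s. v x \<le> \<psi> x \<and> (\<psi> has_real_derivative \<psi>' x) (at x)) \<and>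
        (\<psi>' has_real_derivative c) (at s) \<and> c \<le> F s (v s))"

text \<open>Encoded by the reflection of \<open>y\<close> into \<open>- y\<close>, so that one
  notion and one comparison principle serve both sides.\<close>

definition subsolution_at :: "(real \<Rightarrow> real \<Rightarrow> real) \<Rightarrow> (real \<Rightarrow> real) \<Rightarrow> real \<Rightarrow> bool" where
  "subsolution_at F v s \<longleftrightarrow> supersolution_at (\<lambda>s y. - F s (- y)) (\<lambda>s. - v s) s"

lemma supersolution_atI:
  assumes "\<forall>\<^sub>F x in nhds s. (v has_real_derivative v' x) (at x)"
    and "(v' has_real_derivative c) (at s)" and "c \<le> F s (v s)"
  shows "supersolution_at F v s"
  unfolding supersolution_at_def using assms by (intro exI[of _ v] exI[of _ v'] exI[of _ c]) auto

lemma subsolution_atI: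
  assumes "\<forall>\<^sub>F x in nhds s. (v has_real_derivative v' x) (at x)"
    and "(v' has_real_derivative c) (at s)" and "c \<ge> F s (v s)"
  shows "subsolution_at F v s"
  unfolding subsolution_at_def
proof (rule supersolution_atI)
  show "\<forall>\<^sub>F x in nhds s. ((\<lambda>s. - v s) has_real_derivative - v' x) (at x)"
    using assms(1) by eventually_elim (rule DERIV_minus)
  show "((\<lambda>x. - v' x) has_real_derivative - c) (at s)" using assms(2) by (rule DERIV_minus)
qed (use assms(3) in auto)

text \<open>A function touching \<open>w\<close> from above at \<open>s\<close> also touches
  \<open>v\<close>. This treats minima: at each point the minimum equals one of its members and lies
  below it nearby.\<close>

lemma supersolution_at_touch:
  assumes "supersolution_at F w s" "v s = w s" "\<forall>\<^sub>F x in nhds s. v x \<le> w x"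
  shows "supersolution_at F v s"
proof -
  obtain \<psi> \<psi>' c where *: "\<psi> s = w s"
    "\<forall>\<^sub>F x in nhds s. w x \<le> \<psi> x \<and> (\<psi> has_real_derivative \<psi>' x) (at x)"
    "(\<psi>' has_real_derivative c) (at s)" "c \<le> F s (w s)"
    using assms(1) unfolding supersolution_at_def by auto
  have "\<forall>\<^sub>F x in nhds s. v x \<le> \<psi> x \<and> (\<psi> has_real_derivative \<psi>' x) (at x)"
    using *(2) assms(3) by eventually_elim auto
  then show ?thesis
    unfolding supersolution_at_def using *(1,3,4) assms(2)
    by (intro exI[of _ \<psi>] exI[of _ \<psi>'] exI[of _ c]) simp
qed

lemma supersolution_at_mono:
  assumes "supersolution_at F v s" "F s (v s) \<le> G s (v s)"
  shows "supersolution_at G v s"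
proof -
  obtain \<psi> \<psi>' c where "\<psi> s = v s"
    "\<forall>\<^sub>F x in nhds s. v x \<le> \<psi> x \<and> (\<psi> has_real_derivative \<psi>' x) (at x)"
    "(\<psi>' has_real_derivative c) (at s)" "c \<le> F s (v s)"
    using assms(1) unfolding supersolution_at_def by auto
  then show ?thesis
    unfolding supersolution_at_def using assms(2)
    by (intro exI[of _ \<psi>] exI[of _ \<psi>'] exI[of _ c]) simp
qed

text \<open>The second derivative exists at \<open>s\<close> only. There \<open>v' s = 0\<close>, so
  \<open>v'\<close> is positive just to the right of \<open>s\<close>, and the mean value theorem
  makes \<open>v\<close> exceed \<open>v s\<close>.\<close>

lemma no_local_max_of_second_derivative_pos:
  assumes "\<forall>\<^sub>F x in nhds s. (v has_real_derivative v' x) (at x)"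
    and "(v' has_real_derivative c) (at s)" and c: "c > 0"
    and "\<forall>\<^sub>F x in nhds s. v x \<le> v s"
  shows False
proof -
  obtain d where d: "d > 0" "\<And>x. \<bar>x - s\<bar> < d \<Longrightarrow> (v has_real_derivative v' x) (at x) \<and> v x \<le> v s"
    using eventually_conj[OF assms(1,4)] unfolding eventually_nhds_metric dist_real_def by blast
  have "(v has_real_derivative v' s) (at s)" using d(1) d(2)[of s] by auto
  then have v's: "v' s = 0"
    by (rule DERIV_local_max[OF _ d(1)]) (use d(2) in \<open>auto simp: abs_minus_commute\<close>)
  obtain e where e: "e > 0" "\<And>h. 0 < h \<Longrightarrow> h < e \<Longrightarrow> v' s < v' (s + h)"
    using DERIV_pos_inc_right[OF assms(2) c] by auto
  define r where "r = min d e / 2"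
  have r: "r > 0" "r < d" "r < e" using d(1) e(1) by (auto simp: r_def)
  have "\<exists>z>s. z < s + r \<and> v (s + r) - v s = (s + r - s) * v' z"
    by (rule MVT2) (use r d(2) in auto)
  then obtain z where z: "z > s" "z < s + r" "v (s + r) - v s = r * v' z" by auto
  have "v' z > 0" using e(2)[of "z - s"] z r v's by auto
  then have "v (s + r) > v s" using z(3) r(1) by (smt (verit) mult_pos_pos)
  then show False using d(2)[of "s + r"] r by auto
qed

text \<open>At an interior positive maximum of \<open>u - v\<close> the touching function
  \<open>\<psi>\<close> gives a local maximum of \<open>u - \<psi>\<close>, where the second
  derivative is at least \<open>K * (u s - v s) > 0\<close>.\<close>

lemma comparison_principle:
  fixes u u' v h :: "real \<Rightarrow> real"
  assumes K: "K > 0" and ab: "a < b"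
    and u: "\<And>x. x \<in> {a..b} \<Longrightarrow> (u has_real_derivative u' x) (at x within {a..b})"
    and u': "\<And>x. x \<in> {a..b} \<Longrightarrow> (u' has_real_derivative K * u x + h x) (at x within {a..b})"
    and v: "continuous_on {a..b} v"
    and super: "\<And>x. x \<in> {a<..<b} \<Longrightarrow> supersolution_at (\<lambda>s y. K * y + h s) v x"
    and bdry: "u a \<le> v a" "u b \<le> v b"
    and x: "x \<in> {a..b}"
  shows "u x \<le> v x"
proof (rule ccontr)
  assume neg: "\<not> u x \<le> v x"
  have uc: "continuous_on {a..b} u" by (rule DERIV_continuous_on) (rule u)
  obtain s where s: "s \<in> {a..b}" "\<And>x. x \<in> {a..b} \<Longrightarrow> u x - v x \<le> u s - v s"
    using continuous_attains_sup[of "{a..b}" "\<lambda>x. u x - v x"] uc v ab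
    by (force intro: continuous_on_diff)
  have pos: "u s > v s" using s(2)[OF x] neg by auto
  then have "s \<noteq> a" "s \<noteq> b" using bdry by auto
  with s have si: "s \<in> {a<..<b}" by auto
  obtain \<psi> \<psi>' c where *: "\<psi> s = v s"
    "\<forall>\<^sub>F x in nhds s. v x \<le> \<psi> x \<and> (\<psi> has_real_derivative \<psi>' x) (at x)"
    "(\<psi>' has_real_derivative c) (at s)" "c \<le> K * v s + h s"
    using super[OF si] unfolding supersolution_at_def by auto
  have int: "\<forall>\<^sub>F x in nhds s. x \<in> {a<..<b}"
    using si by (intro eventually_nhds_in_open) auto
  show False
  proof (rule no_local_max_of_second_derivative_pos)
    show "\<forall>\<^sub>F x in nhds s. ((\<lambda>x. u x - \<psi> x) has_real_derivative u' x - \<psi>' x) (at x)"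
      using *(2) int
    proof eventually_elim
      case (elim x)
      then have "(u has_real_derivative u' x) (at x)"
        using u[of x] by (auto simp: at_within_Icc_at)
      then show ?case using elim by (intro DERIV_diff) auto
    qed
    show "((\<lambda>x. u' x - \<psi>' x) has_real_derivative (K * u s + h s) - c) (at s)"
      using u'[of s] si *(3) by (intro DERIV_diff) (auto simp: at_within_Icc_at)
    show "(K * u s + h s) - c > 0"
      using *(4) mult_strict_left_mono[OF pos K] by linarith
    show "\<forall>\<^sub>F x in nhds s. u x - \<psi> x \<le> u s - \<psi> s"
      using *(2) int
    proof eventually_elim
      case (elim x)
      then show ?case using s(2)[of x] *(1) by auto
    qed
  qed
qed

section \<open>The method of sub- and supersolutions\<close>

lemma continuous_on_superposition:
  fixes F :: "real \<Rightarrow> real \<Rightarrow> real"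
  assumes "continuous_on UNIV (\<lambda>(s, y). F s y)" "continuous_on A v"
  shows "continuous_on A (\<lambda>s. F s (v s))"
  using continuous_on_compose2[OF assms(1) continuous_on_Pair[OF continuous_on_id assms(2)]]
  by simp

lemma tendsto_superposition:
  fixes F :: "real \<Rightarrow> real \<Rightarrow> real"
  assumes "continuous_on UNIV (\<lambda>(s, y). F s y)" "f \<longlonglongrightarrow> l"
  shows "(\<lambda>n. F s (f n)) \<longlonglongrightarrow> F s l"
proof -
  have "continuous_on UNIV (F s)"
    using continuous_on_compose2[OF assms(1) continuous_on_Pair[OF continuous_on_const continuous_on_id]]
    by simp
  then show ?thesis
    using assms(2) continuous_on_tendsto_compose by fastforce
qed

lemma bounded_on_box:
  fixes F :: "real \<Rightarrow> real \<Rightarrow> real"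
  assumes "continuous_on UNIV (\<lambda>(s, y). F s y)"
  obtains C where "\<And>s y. s \<in> {a..b} \<Longrightarrow> y \<in> {c..d} \<Longrightarrow> \<bar>F s y\<bar> \<le> C"
proof -
  have "compact ((\<lambda>(s, y). F s y) ` ({a..b} \<times> {c..d}))"
    by (intro compact_continuous_image continuous_on_subset[OF assms] compact_Times) auto
  then have "bounded ((\<lambda>(s, y). F s y) ` ({a..b} \<times> {c..d}))"
    by (rule compact_imp_bounded)
  then obtain C where "\<forall>z\<in>(\<lambda>(s, y). F s y) ` ({a..b} \<times> {c..d}). norm z \<le> C"
    unfolding bounded_iff by auto
  then show thesis by (intro that[of C]) force
qed

text \<open>Monotone iteration from \<open>up\<close>: each step solves
  \<open>w'' = K w + (F s v - K v)\<close> with the boundary values of \<open>up\<close>. The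
  one-sided Lipschitz bound makes \<open>F s y - K y\<close> nonincreasing in \<open>y\<close>, so
  the iterates decrease. The maximality clause is what later makes the solutions on growing
  intervals monotone.\<close>

proposition maximal_solution_on_interval:
  fixes F :: "real \<Rightarrow> real \<Rightarrow> real" and lo up :: "real \<Rightarrow> real"
  assumes ab: "a < b"
    and F: "continuous_on UNIV (\<lambda>(s, y). F s y)"
    and K: "K > 0"
    and lip: "\<And>s x y. \<lbrakk>s \<in> {a..b}; - M \<le> x; x \<le> y; y \<le> M\<rbrakk> \<Longrightarrow> F s y - F s x \<le> K * (y - x)"
    and lo: "continuous_on {a..b} lo" "\<And>s. s \<in> {a<..<b} \<Longrightarrow> subsolution_at F lo s"
    and up: "continuous_on {a..b} up" "\<And>s. s \<in> {a<..<b} \<Longrightarrow> supersolution_at F up s"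
    and lo_up: "\<And>s. s \<in> {a..b} \<Longrightarrow> - M \<le> lo s \<and> lo s \<le> up s \<and> up s \<le> M"
  obtains y y' where
    "\<And>s. s \<in> {a..b} \<Longrightarrow> (y has_real_derivative y' s) (at s within {a..b})"
    "\<And>s. s \<in> {a..b} \<Longrightarrow> (y' has_real_derivative F s (y s)) (at s within {a..b})"
    "\<And>s. s \<in> {a..b} \<Longrightarrow> lo s \<le> y s \<and> y s \<le> up s"
    "\<And>v s. \<lbrakk>continuous_on {a..b} v; \<And>s. s \<in> {a<..<b} \<Longrightarrow> subsolution_at F v s;
       \<And>s. s \<in> {a..b} \<Longrightarrow> lo s \<le> v s \<and> v s \<le> up s; s \<in> {a..b}\<rbrakk> \<Longrightarrow> v s \<le> y s"
proof -
  define h where "h = (\<lambda>v s. F s (v s) - K * v s)"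
  define solves where "solves = (\<lambda>v w w'.
    (\<forall>s\<in>{a..b}. (w has_real_derivative w' s) (at s within {a..b})) \<and>
    (\<forall>s\<in>{a..b}. (w' has_real_derivative K * w s + h v s) (at s within {a..b})) \<and>
    w a = up a \<and> w b = up b)"
  define S where "S = (\<lambda>v. SOME w. \<exists>w'. solves v w w')"
  have hc: "continuous_on {a..b} (h v)" if "continuous_on {a..b} v" for v
    unfolding h_def using that by (intro continuous_intros continuous_on_superposition[OF F])
  have S: "\<exists>w'. solves v (S v) w'" if v: "continuous_on {a..b} v" for v
  proof -
    obtain w w' where "\<And>x. x \<in> {a..b} \<Longrightarrow> (w has_real_derivative w' x) (at x within {a..b})"
      "\<And>x. x \<in> {a..b} \<Longrightarrow> (w' has_real_derivative (sqrt K)\<^sup>2 * w x + h v x) (at x within {a..b})"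
      "w a = up a" "w b = up b"
      using bounded_linear_bvp[of "sqrt K" a b "h v" "up a" "up b"] K ab hc[OF v] by auto
    then have "\<exists>w. \<exists>w'. solves v w w'" unfolding solves_def using K by (intro exI[of _ w] exI[of _ w']) auto
    then show ?thesis unfolding S_def by (rule someI_ex)
  qed
  \<comment> \<open>The invariant of the iteration. The supersolution property forces the next
    iterate below the present one; the fixed boundary values supply the boundary inequalities of
    every comparison.\<close>
  define inv where "inv = (\<lambda>v. continuous_on {a..b} v \<and>
    (\<forall>s\<in>{a<..<b}. supersolution_at F v s) \<and> (\<forall>s\<in>{a..b}. lo s \<le> v s \<and> v s \<le> up s) \<and>
    v a = up a \<and> v b = up b)"
  \<comment> \<open>Since \<open>z \<le> v\<close>, the Lipschitz bound turns the subsolution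
    \<open>z\<close> of the nonlinear equation into a subsolution of the linear one with source
    \<open>h v\<close>. The comparison principle is applied to the negatives.\<close>
  have below: "z s \<le> w s"
    if v: "inv v" and w: "solves v w w'" and z: "continuous_on {a..b} z"
      "\<And>s. s \<in> {a<..<b} \<Longrightarrow> subsolution_at F z s"
      "\<And>s. s \<in> {a..b} \<Longrightarrow> lo s \<le> z s \<and> z s \<le> v s" and s: "s \<in> {a..b}" for v w w' z s
  proof -
    have "- w s \<le> - z s"
    proof (rule comparison_principle[OF K ab, of "\<lambda>s. - w s" "\<lambda>s. - w' s" "\<lambda>s. - h v s"])
      show "((\<lambda>s. - w s) has_real_derivative - w' x) (at x within {a..b})" if "x \<in> {a..b}" for x
        using w that unfolding solves_def by (intro DERIV_minus) auto
      show "((\<lambda>s. - w' s) has_real_derivative K * - w x + - h v x) (at x within {a..b})"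
        if "x \<in> {a..b}" for x
        using DERIV_minus[of w' "K * w x + h v x" x "{a..b}"] w that unfolding solves_def by auto
      show "continuous_on {a..b} (\<lambda>s. - z s)" by (intro continuous_intros z)
      show "supersolution_at (\<lambda>s y. K * y + - h v s) (\<lambda>s. - z s) x" if x: "x \<in> {a<..<b}" for x
      proof (rule supersolution_at_mono)
        show "supersolution_at (\<lambda>s y. - F s (- y)) (\<lambda>s. - z s) x"
          using z(2)[OF x] by (simp add: subsolution_at_def)
        have "F x (v x) - F x (z x) \<le> K * (v x - z x)"
        proof (rule lip)
          have "v x \<le> up x" using v x unfolding inv_def by auto
          then show "v x \<le> M" using lo_up[of x] x by auto
        qed (use x lo_up[of x] z(3)[of x] in auto)
        then show "- F x (- (- z x)) \<le> K * - z x + - h v x"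
          by (simp add: h_def algebra_simps)
      qed
      show "- w a \<le> - z a" "- w b \<le> - z b"
        using w z(3)[of a] z(3)[of b] v ab unfolding solves_def inv_def by auto
    qed (use s in auto)
    then show ?thesis by simp
  qed
  have above: "w s \<le> v s" if v: "inv v" and w: "solves v w w'" and s: "s \<in> {a..b}" for v w w' s
  proof (rule comparison_principle[OF K ab, of w w' "h v"])
    show "supersolution_at (\<lambda>s y. K * y + h v s) v x" if x: "x \<in> {a<..<b}" for x
      by (rule supersolution_at_mono[of F]) (use v x in \<open>auto simp: inv_def h_def\<close>)
  qed (use v w s in \<open>auto simp: inv_def solves_def\<close>)
  have inv_step: "inv (S v)" if v: "inv v" for v
  proof -
    obtain w' where w': "solves v (S v) w'" using S v unfolding inv_def by blast
    have 1: "lo s \<le> S v s" if "s \<in> {a..b}" for s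
      by (rule below[OF v w' lo]) (use that v in \<open>auto simp: inv_def\<close>)
    have 2: "S v s \<le> v s" if "s \<in> {a..b}" for s
      by (rule above[OF v w' that])
    have "continuous_on {a..b} (S v)"
      by (rule DERIV_continuous_on[of _ _ w']) (use w' in \<open>auto simp: solves_def\<close>)
    moreover have "supersolution_at F (S v) s" if s: "s \<in> {a<..<b}" for s
    proof (rule supersolution_atI[of _ w' _ "K * S v s + h v s"])
      have int: "\<forall>\<^sub>F x in nhds s. x \<in> {a<..<b}"
        using s by (intro eventually_nhds_in_open) auto
      show "\<forall>\<^sub>F x in nhds s. (S v has_real_derivative w' x) (at x)"
        using int
      proof eventually_elim
        case (elim x)
        then show ?case using w' unfolding solves_def by (auto simp flip: at_within_Icc_at)
      qed
      show "(w' has_real_derivative K * S v s + h v s) (at s)"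
        using w' s unfolding solves_def by (auto simp flip: at_within_Icc_at)
      \<comment> \<open>Because \<open>S v \<le> v\<close>, the same bound shows that the new
        iterate, an exact solution of the linear problem, is again a supersolution of the nonlinear
        one.\<close>
      have "F s (v s) - F s (S v s) \<le> K * (v s - S v s)"
      proof (rule lip)
        have "v s \<le> up s" using v s unfolding inv_def by auto
        then show "v s \<le> M" using lo_up[of s] s by auto
      qed (use s lo_up[of s] 1[of s] 2[of s] in auto)
      then show "K * S v s + h v s \<le> F s (S v s)"
        by (simp add: h_def algebra_simps)
    qed
    moreover have "lo s \<le> S v s \<and> S v s \<le> up s" if s: "s \<in> {a..b}" for s
    proof -
      have "v s \<le> up s" using v s unfolding inv_def by auto
      then show ?thesis using 1[OF s] 2[OF s] by auto
    qed
    moreover have "S v a = up a" "S v b = up b" using w' unfolding solves_def by auto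
    ultimately show ?thesis unfolding inv_def by blast
  qed
  define y where "y = (\<lambda>n. (S ^^ n) up)"
  have y0: "y 0 = up" and ySuc: "y (Suc n) = S (y n)" for n by (simp_all add: y_def)
  have inv: "inv (y n)" for n
  proof (induction n)
    case 0
    then show ?case using up lo_up ab by (auto simp: y0 inv_def)
  qed (simp add: ySuc inv_step)
  obtain y' where y': "\<And>n. solves (y n) (y (Suc n)) (y' n)"
  proof -
    have "\<exists>w'. solves (y n) (y (Suc n)) w'" for n
      using S[of "y n"] inv[of n] unfolding ySuc inv_def by blast
    then show ?thesis using that by metis
  qed
  have dec: "y (Suc n) s \<le> y n s" if "s \<in> {a..b}" for n s
    by (rule above[OF inv y' that])
  have bd: "lo s \<le> y n s \<and> y n s \<le> up s" if "s \<in> {a..b}" for n s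
    using inv[of n] that unfolding inv_def by auto
  define Y where "Y = (\<lambda>s. lim (\<lambda>n. y n s))"
  have Y: "(\<lambda>n. y n s) \<longlonglongrightarrow> Y s" if s: "s \<in> {a..b}" for s
  proof -
    have "decseq (\<lambda>n. y n s)" using dec[OF s] by (simp add: decseq_Suc_iff)
    then have "convergent (\<lambda>n. y n s)"
      using decseq_convergent[of "\<lambda>n. y n s" "lo s"] bd[OF s] by (metis convergentI)
    then show ?thesis unfolding Y_def by (simp add: convergent_LIMSEQ_iff)
  qed
  have Ybd: "lo s \<le> Y s \<and> Y s \<le> up s" if s: "s \<in> {a..b}" for s
    using LIMSEQ_le_const[OF Y[OF s], of "lo s"] LIMSEQ_le_const2[OF Y[OF s], of "up s"] bd[OF s]
    by auto
  have max: "v s \<le> Y s" if v: "continuous_on {a..b} v" "\<And>s. s \<in> {a<..<b} \<Longrightarrow> subsolution_at F v s"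
     "\<And>s. s \<in> {a..b} \<Longrightarrow> lo s \<le> v s \<and> v s \<le> up s" and s: "s \<in> {a..b}" for v s
  proof -
    have "\<forall>s\<in>{a..b}. v s \<le> y n s" for n
    proof (induction n)
      case (Suc n)
      show ?case by (intro ballI below[OF inv y' v(1,2)]) (use v(3) Suc in auto)
    qed (use v(3) y0 in auto)
    then show ?thesis using LIMSEQ_le_const[OF Y[OF s], of "v s"] s by auto
  qed
  obtain C where C: "\<And>s y. s \<in> {a..b} \<Longrightarrow> y \<in> {-M..M} \<Longrightarrow> \<bar>F s y\<bar> \<le> C"
    using bounded_on_box[OF F] by metis
  have yM: "y n s \<in> {-M..M}" if "s \<in> {a..b}" for n s
    using bd[OF that, of n] lo_up[OF that] by auto
  \<comment> \<open>The second derivative of \<open>y (Suc n)\<close>; its two terms with factor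
    \<open>K\<close> belong to consecutive iterates and cancel in the limit.\<close>
  define H where "H = (\<lambda>n s. K * y (Suc n) s + h (y n) s)"
  obtain Y' where Y': "\<And>x. x \<in> {a..b} \<Longrightarrow> (Y has_real_derivative Y' x) (at x within {a..b})"
    "\<And>x. x \<in> {a..b} \<Longrightarrow> (Y' has_real_derivative F x (Y x)) (at x within {a..b})"
  proof (rule second_derivative_limit[of a b "\<lambda>n. y (Suc n)" y' H "C + 2 * K * M" Y "\<lambda>x. F x (Y x)"])
    show "continuous_on {a..b} (H n)" for n
      unfolding H_def using inv by (intro continuous_intros hc) (auto simp: inv_def)
    show "\<bar>H n x\<bar> \<le> C + 2 * K * M" if x: "x \<in> {a..b}" for n x
    proof -
      have "\<bar>K * y (Suc n) x\<bar> \<le> K * M" "\<bar>K * y n x\<bar> \<le> K * M"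
        using yM[OF x, of n] yM[OF x, of "Suc n"] K by (auto simp: abs_mult intro!: mult_left_mono)
      then show ?thesis using C[OF x yM[OF x, of n]] unfolding H_def h_def by linarith
    qed
    show "(\<lambda>n. y (Suc n) x) \<longlonglongrightarrow> Y x" if "x \<in> {a..b}" for x
      using Y[OF that] by (rule LIMSEQ_Suc)
    show "(\<lambda>n. H n x) \<longlonglongrightarrow> F x (Y x)" if x: "x \<in> {a..b}" for x
    proof -
      have "(\<lambda>n. H n x) \<longlonglongrightarrow> K * Y x + (F x (Y x) - K * Y x)"
        unfolding H_def h_def
        by (intro tendsto_intros LIMSEQ_Suc Y[OF x] tendsto_superposition[OF F])
      then show ?thesis by simp
    qed
    show "continuous_on {a..b} (\<lambda>x. F x (Y x))" if "continuous_on {a..b} Y"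
      by (rule continuous_on_superposition[OF F that])
  qed (use ab y' in \<open>auto simp: solves_def H_def\<close>)
  show thesis
    by (rule that[of Y Y']) (use Y' Ybd max in auto)
qed

text \<open>The line is exhausted by the intervals \<open>I n\<close>. The maximal solutions on them
  decrease with \<open>n\<close>, and on each fixed \<open>I k\<close> their limit solves the
  equation by the limit lemma.\<close>

theorem solution_between_sub_and_supersolution:
  fixes F :: "real \<Rightarrow> real \<Rightarrow> real" and lo up :: "real \<Rightarrow> real"
  assumes F: "continuous_on UNIV (\<lambda>(s, y). F s y)"
    and lip: "\<And>N M. \<exists>K>0. \<forall>s x y. \<bar>s\<bar> \<le> N \<longrightarrow> - M \<le> x \<longrightarrow> x \<le> y \<longrightarrow> y \<le> M
                 \<longrightarrow> F s y - F s x \<le> K * (y - x)"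
    and lo: "continuous_on UNIV lo" "\<And>s. subsolution_at F lo s"
    and up: "continuous_on UNIV up" "\<And>s. supersolution_at F up s"
    and lo_up: "\<And>s. lo s \<le> up s"
  obtains y y' where
    "\<And>s. (y has_real_derivative y' s) (at s)"
    "\<And>s. (y' has_real_derivative F s (y s)) (at s)"
    "\<And>s. lo s \<le> y s \<and> y s \<le> up s"
proof -
  define I where "I = (\<lambda>n. {- real (Suc n)..real (Suc n)})"
  have I_eq: "I n = {- real (Suc n)..real (Suc n)}" for n by (simp add: I_def)
  have "\<exists>M. \<forall>s\<in>I n. - M \<le> lo s \<and> up s \<le> M" for n
  proof -
    have "bounded (v ` I n)" if "continuous_on UNIV v" for v :: "real \<Rightarrow> real"
      unfolding I_def
      by (intro compact_imp_bounded compact_continuous_image continuous_on_subset[OF that]) auto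
    then obtain A B where "\<forall>z\<in>lo ` I n. norm z \<le> A" "\<forall>z\<in>up ` I n. norm z \<le> B"
      using lo(1) up(1) unfolding bounded_iff by metis
    then show ?thesis by (intro exI[of _ "max A B"]) force
  qed
  then obtain M where M: "\<And>n s. s \<in> I n \<Longrightarrow> - M n \<le> lo s \<and> up s \<le> M n" by metis
  have "\<exists>y y'. (\<forall>s\<in>I n. (y has_real_derivative y' s) (at s within I n)) \<and>
      (\<forall>s\<in>I n. (y' has_real_derivative F s (y s)) (at s within I n)) \<and>
      (\<forall>s\<in>I n. lo s \<le> y s \<and> y s \<le> up s) \<and>
      (\<forall>v. continuous_on (I n) v \<longrightarrow> (\<forall>s\<in>{- real (Suc n)<..<real (Suc n)}. subsolution_at F v s) \<longrightarrow>
         (\<forall>s\<in>I n. lo s \<le> v s \<and> v s \<le> up s) \<longrightarrow> (\<forall>s\<in>I n. v s \<le> y s))" for n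
  proof -
    obtain K where K: "K > 0" "\<And>s x y. \<lbrakk>\<bar>s\<bar> \<le> real (Suc n); - M n \<le> x; x \<le> y; y \<le> M n\<rbrakk>
        \<Longrightarrow> F s y - F s x \<le> K * (y - x)"
      using lip by metis
    show ?thesis
    proof (rule maximal_solution_on_interval[of "- real (Suc n)" "real (Suc n)" F K "M n" lo up],
        goal_cases)
      case (10 y y')
      show ?case
        unfolding I_def
        by (rule exI[of _ y], rule exI[of _ y'], intro conjI ballI allI impI) (use 10 in auto)
    qed (use F K lo up lo_up M[of _ n] in \<open>auto simp: I_def intro: continuous_on_subset\<close>)
  qed
  then obtain y y' where
    y: "\<And>n s. s \<in> I n \<Longrightarrow> (y n has_real_derivative y' n s) (at s within I n)" and
    y': "\<And>n s. s \<in> I n \<Longrightarrow> (y' n has_real_derivative F s (y n s)) (at s within I n)" and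
    bd: "\<And>n s. s \<in> I n \<Longrightarrow> lo s \<le> y n s \<and> y n s \<le> up s" and
    max: "\<And>n v s. \<lbrakk>continuous_on (I n) v; \<And>s. s \<in> {- real (Suc n)<..<real (Suc n)} \<Longrightarrow> subsolution_at F v s;
         \<And>s. s \<in> I n \<Longrightarrow> lo s \<le> v s \<and> v s \<le> up s; s \<in> I n\<rbrakk> \<Longrightarrow> v s \<le> y n s"
    by metis
  have I_mono: "I m \<subseteq> I n" if "m \<le> n" for m n using that by (auto simp: I_def)
  have I_near: "\<forall>\<^sub>F x in nhds s. x \<in> {- real (Suc n)<..<real (Suc n)}"
    if "s \<in> {- real (Suc n)<..<real (Suc n)}" for n s
    using that by (intro eventually_nhds_in_open) auto
  have at: "at s within I n = at s" if "s \<in> {- real (Suc n)<..<real (Suc n)}" for n s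
    using that unfolding I_def by (intro at_within_Icc_at) auto
  have yc: "continuous_on (I n) (y n)" for n
    by (rule DERIV_continuous_on) (rule y)
  \<comment> \<open>The restriction of \<open>y (Suc n)\<close> to the smaller interval is a
    subsolution between \<open>lo\<close> and \<open>up\<close>, so the maximality of
    \<open>y n\<close> applies to it.\<close>
  have dec: "y (Suc n) s \<le> y n s" if s: "s \<in> I n" for n s
  proof (rule max[OF _ _ _ s])
    show "continuous_on (I n) (y (Suc n))"
      by (rule continuous_on_subset[OF yc I_mono]) simp
    show "lo s \<le> y (Suc n) s \<and> y (Suc n) s \<le> up s" if "s \<in> I n" for s
      using bd[of s "Suc n"] I_mono[of n "Suc n"] that by auto
    fix s assume "s \<in> {- real (Suc n)<..<real (Suc n)}"
    then have s: "s \<in> {- real (Suc (Suc n))<..<real (Suc (Suc n))}" by auto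
    show "subsolution_at F (y (Suc n)) s"
    proof (rule subsolution_atI)
      show "\<forall>\<^sub>F x in nhds s. (y (Suc n) has_real_derivative y' (Suc n) x) (at x)"
        using I_near[OF s]
      proof eventually_elim
        case (elim x)
        then show ?case using y[of x "Suc n"] at[OF elim] by (auto simp: I_def)
      qed
      show "(y' (Suc n) has_real_derivative F s (y (Suc n) s)) (at s)"
        using y'[of s "Suc n"] at[OF s] s by (auto simp: I_def)
    qed simp
  qed
  have dec': "y n s \<le> y k s" if "s \<in> I k" "k \<le> n" for n k s
    using that(2)
  proof (induction rule: dec_induct)
    case (step m)
    then show ?case using dec[of s m] I_mono[of k m] that(1) by force
  qed simp
  define Y where "Y = (\<lambda>s. lim (\<lambda>n. y n s))"
  have Y: "(\<lambda>n. y (n + k) s) \<longlonglongrightarrow> Y s" if s: "s \<in> I k" for s k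
  proof -
    have "decseq (\<lambda>n. y (n + k) s)"
      unfolding decseq_Suc_iff using dec[of s] I_mono s by (metis add_Suc le_add2 subset_eq)
    moreover have "lo s \<le> y (n + k) s" for n using bd[of s "n + k"] I_mono[of k "n + k"] s by auto
    ultimately have "convergent (\<lambda>n. y (n + k) s)"
      using decseq_convergent[of "\<lambda>n. y (n + k) s" "lo s"] by (metis convergentI)
    then have "convergent (\<lambda>n. y n s)"
      unfolding convergent_def by (auto dest: LIMSEQ_offset)
    then have "(\<lambda>n. y n s) \<longlonglongrightarrow> Y s" unfolding Y_def by (simp add: convergent_LIMSEQ_iff)
    then show ?thesis by (rule LIMSEQ_ignore_initial_segment)
  qed
  have Ybd: "lo s \<le> Y s \<and> Y s \<le> up s" if s: "s \<in> I k" for s k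
  proof -
    have "lo s \<le> y (n + k) s \<and> y (n + k) s \<le> up s" for n
      using bd[of s "n + k"] I_mono[of k "n + k"] s by auto
    then show ?thesis
      using LIMSEQ_le_const[OF Y[OF s], of "lo s"] LIMSEQ_le_const2[OF Y[OF s], of "up s"] by auto
  qed
  have "\<exists>Y'. (\<forall>x\<in>I k. (Y has_real_derivative Y' x) (at x within I k)) \<and>
      (\<forall>x\<in>I k. (Y' has_real_derivative F x (Y x)) (at x within I k))" for k
  proof -
    obtain C where C: "\<And>s y. s \<in> I k \<Longrightarrow> y \<in> {-M k..M k} \<Longrightarrow> \<bar>F s y\<bar> \<le> C"
      using bounded_on_box[OF F, of "- real (Suc k)" "real (Suc k)" "- M k" "M k"]
      unfolding I_def by metis
    have I_sub: "I k \<subseteq> I (n + k)" for n by (rule I_mono) simp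
    have yM: "y (n + k) s \<in> {-M k..M k}" if "s \<in> I k" for n s
      using bd[of s "n + k"] M[OF that] I_sub[of n] that by force
    obtain Y' where "\<And>x. x \<in> I k \<Longrightarrow> (Y has_real_derivative Y' x) (at x within I k)"
      "\<And>x. x \<in> I k \<Longrightarrow> (Y' has_real_derivative F x (Y x)) (at x within I k)"
    proof (rule second_derivative_limit[of "- real (Suc k)" "real (Suc k)" "\<lambda>n. y (n + k)"
          "\<lambda>n. y' (n + k)" "\<lambda>n x. F x (y (n + k) x)" C Y "\<lambda>x. F x (Y x)",
          folded I_eq])
      show "(y (n + k) has_real_derivative y' (n + k) x) (at x within I k)" if "x \<in> I k" for n x
        using y[of x "n + k"] I_sub[of n] that by (meson DERIV_subset subset_iff)
      show "(y' (n + k) has_real_derivative F x (y (n + k) x)) (at x within I k)" if "x \<in> I k" for n x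
        using y'[of x "n + k"] I_sub[of n] that by (meson DERIV_subset subset_iff)
      show "continuous_on (I k) (\<lambda>x. F x (y (n + k) x))" for n
        by (intro continuous_on_superposition[OF F] continuous_on_subset[OF yc I_sub])
      show "\<bar>F x (y (n + k) x)\<bar> \<le> C" if "x \<in> I k" for n x
        using C[OF that yM[OF that]] .
      show "(\<lambda>n. F x (y (n + k) x)) \<longlonglongrightarrow> F x (Y x)" if "x \<in> I k" for x
        by (rule tendsto_superposition[OF F Y[OF that]])
      show "continuous_on (I k) (\<lambda>x. F x (Y x))" if "continuous_on (I k) Y"
        by (rule continuous_on_superposition[OF F that])
    qed (use Y in auto)
    then show ?thesis by blast
  qed
  then obtain Y' where
    Y': "\<And>k x. x \<in> I k \<Longrightarrow> (Y has_real_derivative Y' k x) (at x within I k)"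
    "\<And>k x. x \<in> I k \<Longrightarrow> (Y' k has_real_derivative F x (Y x)) (at x within I k)"
    by metis
  have cover: "\<exists>k. s \<in> {- real (Suc k)<..<real (Suc k)}" for s
  proof -
    obtain k where "\<bar>s\<bar> < real k" using reals_Archimedean2 by blast
    then show ?thesis by (intro exI[of _ k]) auto
  qed
  have dY: "(Y has_real_derivative Y' k s) (at s)" if "s \<in> {- real (Suc k)<..<real (Suc k)}" for k s
    using Y'(1)[of s k] at[OF that] that by (auto simp: I_def)
  \<comment> \<open>The derivatives \<open>Y' k\<close> depend on the interval; inside it they agree
    with \<open>deriv Y\<close>, which patches the local equations into one.\<close>
  have dY': "(deriv Y has_real_derivative F s (Y s)) (at s)"
    if s: "s \<in> {- real (Suc k)<..<real (Suc k)}" for k s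
  proof -
    have "(Y' k has_real_derivative F s (Y s)) (at s)"
      using Y'(2)[of s k] at[OF s] s by (auto simp: I_def)
    moreover have "\<forall>\<^sub>F x in nhds s. Y' k x = deriv Y x"
      using I_near[OF s] by eventually_elim (metis dY DERIV_imp_deriv)
    ultimately show ?thesis using DERIV_cong_ev[OF refl _ refl] by metis
  qed
  show thesis
  proof (rule that[of Y "deriv Y"])
    fix s
    obtain k where k: "s \<in> {- real (Suc k)<..<real (Suc k)}" using cover by blast
    show "(Y has_real_derivative deriv Y s) (at s)" using dY[OF k] DERIV_imp_deriv by metis
    show "(deriv Y has_real_derivative F s (Y s)) (at s)" by (rule dY'[OF k])
    show "lo s \<le> Y s \<and> Y s \<le> up s" by (rule Ybd[of s k]) (use k in \<open>auto simp: I_def\<close>)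
  qed
qed

section \<open>Convexity and crossing arguments\<close>

lemma taylor_lower_bound:
  fixes D D' D'' :: "real \<Rightarrow> real"
  assumes D: "\<And>s. s \<ge> S \<Longrightarrow> (D has_real_derivative D' s) (at s)"
    and D': "\<And>s. s \<ge> S \<Longrightarrow> (D' has_real_derivative D'' s) (at s)"
    and D'': "\<And>s. s \<ge> S \<Longrightarrow> D'' s \<ge> c" and s: "s \<ge> S"
  shows "D s \<ge> D S + D' S * (s - S) + c / 2 * (s - S)\<^sup>2"
proof -
  have *: "D' s - c * s \<ge> D' S - c * S" if "s \<ge> S" for s
  proof (rule DERIV_nonneg_imp_nondecreasing[OF that])
    fix x assume "S \<le> x"
    then show "\<exists>y. ((\<lambda>s. D' s - c * s) has_real_derivative y) (at x) \<and> 0 \<le> y"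
      using D'[of x] D''[of x]
      by (intro exI[of _ "D'' x - c"]) (auto intro!: derivative_eq_intros)
  qed
  have "D s - D' S * (s - S) - c / 2 * (s - S)\<^sup>2 \<ge> D S - D' S * (S - S) - c / 2 * (S - S)\<^sup>2"
  proof (rule DERIV_nonneg_imp_nondecreasing[OF s])
    fix x assume "S \<le> x"
    then show "\<exists>y. ((\<lambda>s. D s - D' S * (s - S) - c / 2 * (s - S)\<^sup>2) has_real_derivative y) (at x) \<and> 0 \<le> y"
      using D[of x] *[of x]
      by (intro exI[of _ "D' x - D' S - c * (x - S)"]) (auto intro!: derivative_eq_intros simp: field_simps)
  qed
  then show ?thesis by simp
qed

lemma uniformly_convex_unbounded:
  fixes D D' D'' :: "real \<Rightarrow> real"
  assumes D: "\<And>s. s \<ge> S \<Longrightarrow> (D has_real_derivative D' s) (at s)"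
    and D': "\<And>s. s \<ge> S \<Longrightarrow> (D' has_real_derivative D'' s) (at s)"
    and D'': "\<And>s. s \<ge> S \<Longrightarrow> D'' s \<ge> c" and c: "c > 0"
  obtains s where "s \<ge> S" "D s > M"
proof -
  \<comment> \<open>\<open>B\<close> collects the slope and all constants. The choice of
    \<open>x\<close> gives \<open>c / 2 * x \<ge> B\<close> and \<open>x \<ge> 1\<close>, so the
    quadratic term beats them together.\<close>
  define B where "B = \<bar>M\<bar> + \<bar>D S\<bar> + \<bar>D' S\<bar> + 1"
  define x where "x = max 1 (2 / c * B)"
  have x: "x \<ge> 1" "x \<ge> 2 / c * B" by (simp_all add: x_def)
  then have "c / 2 * x \<ge> B" using c by (simp add: field_simps)
  then have "c / 2 * x\<^sup>2 \<ge> B * x" using x by (simp add: power2_eq_square)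
  moreover have "D' S * x \<ge> - (\<bar>D' S\<bar> * x)"
    using mult_right_mono[of "- \<bar>D' S\<bar>" "D' S" x] x by simp
  moreover have "D (S + x) \<ge> D S + D' S * x + c / 2 * x\<^sup>2"
    using taylor_lower_bound[of S D D' D'' c "S + x", OF D D' D''] x by simp
  moreover have "(\<bar>M\<bar> + \<bar>D S\<bar> + 1) * x \<ge> \<bar>M\<bar> + \<bar>D S\<bar> + 1"
    using mult_left_mono[of 1 x "\<bar>M\<bar> + \<bar>D S\<bar> + 1"] x by simp
  moreover have "B * x = (\<bar>M\<bar> + \<bar>D S\<bar> + 1) * x + \<bar>D' S\<bar> * x"
    by (simp add: B_def algebra_simps)
  ultimately have "D (S + x) > M" by linarith
  then show thesis using that[of "S + x"] x by simp
qed

lemma first_zero: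
  fixes D :: "real \<Rightarrow> real"
  assumes c: "continuous_on {x..y} D" and xy: "x \<le> y" and "D x > 0" "D y \<le> 0"
  obtains z where "x < z" "z \<le> y" "D z = 0" "\<And>w. x \<le> w \<Longrightarrow> w < z \<Longrightarrow> D w > 0"
proof -
  define A where "A = {x..y} \<inter> D -` {..0}"
  have "closed A" unfolding A_def
    by (intro continuous_closed_preimage[OF c]) auto
  then have "compact A"
    unfolding A_def by (metis Int_commute compact_Icc compact_Int_closed inf.idem inf_assoc)
  then obtain z where z: "z \<in> A" "\<And>w. w \<in> A \<Longrightarrow> z \<le> w"
    using compact_attains_inf[of A] assms by (force simp: A_def)
  have pos: "D w > 0" if "x \<le> w" "w < z" for w
    using z that by (force simp: A_def not_le)
  have "x < z" using z(1) \<open>D x > 0\<close> by (auto simp: A_def less_le)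
  moreover have "D z = 0"
  proof (rule ccontr)
    assume "D z \<noteq> 0"
    with z(1) have neg: "D z < 0" by (auto simp: A_def)
    have "\<exists>w\<ge>x. w \<le> z \<and> D w = 0"
      by (rule IVT2') (use neg \<open>D x > 0\<close> \<open>x < z\<close> z(1) in \<open>auto simp: A_def intro: continuous_on_subset[OF c]\<close>)
    then show False using pos neg by (metis less_le less_irrefl)
  qed
  ultimately show thesis using that[of z] z(1) pos by (auto simp: A_def)
qed

text \<open>At the first return to zero \<open>D\<close> would come down from positive values,
  contradicting the positive derivative there. If \<open>D x = 0\<close>, the argument starts
  slightly to the right of \<open>x\<close>.\<close>

lemma no_down_crossing:
  fixes D D' :: "real \<Rightarrow> real"
  assumes D: "\<And>s. s \<in> {x..y} \<Longrightarrow> (D has_real_derivative D' s) (at s)"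
    and xy: "x < y" and Dx: "D x \<ge> 0"
    and zero: "\<And>s. s \<in> {x..y} \<Longrightarrow> D s = 0 \<Longrightarrow> D' s > 0"
  shows "D y > 0"
proof (rule ccontr)
  assume "\<not> D y > 0"
  then have Dy: "D y \<le> 0" by simp
  obtain x' where x': "x \<le> x'" "x' < y" "D x' > 0"
  proof (cases "D x = 0")
    case True
    then obtain d where d: "d > 0" "\<And>h. 0 < h \<Longrightarrow> h < d \<Longrightarrow> D x < D (x + h)"
      using DERIV_pos_inc_right[OF D zero] xy by (metis atLeastAtMost_iff less_imp_le order_refl)
    show ?thesis
      using d(2)[of "min d (y - x) / 2"] d(1) xy True
      by (intro that[of "x + min d (y - x) / 2"]) (auto simp: min_def field_simps)
  next
    case False
    then show ?thesis using that[of x] xy Dx by auto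
  qed
  have "continuous_on {x'..y} D"
    by (rule DERIV_continuous_on[of _ _ D']) (use D x' in \<open>auto intro: has_field_derivative_at_within\<close>)
  then obtain z where z: "x' < z" "z \<le> y" "D z = 0" "\<And>w. x' \<le> w \<Longrightarrow> w < z \<Longrightarrow> D w > 0"
    using first_zero[of x' y D] x' Dy by auto
  have zxy: "z \<in> {x..y}" using z x' by auto
  obtain d where d: "d > 0" "\<And>h. 0 < h \<Longrightarrow> h < d \<Longrightarrow> D (z - h) < D z"
    using DERIV_pos_inc_left[OF D[OF zxy] zero[OF zxy z(3)]] by auto
  define h where "h = min d (z - x') / 2"
  have "h > 0" "h < d" "h < z - x'" using d(1) z(1) by (auto simp: h_def)
  then show False using d(2)[of h] z(3) z(4)[of "z - h"] by auto
qed

text \<open>Up to a first zero \<open>D\<close> would be convex with nonnegative slope, hence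
  nondecreasing, so it could not reach zero. Thus \<open>D\<close> stays positive and the convexity
  bound holds throughout.\<close>

lemma uniformly_convex_where_positive_unbounded:
  fixes D D' D'' :: "real \<Rightarrow> real"
  assumes D: "\<And>s. s \<ge> x \<Longrightarrow> (D has_real_derivative D' s) (at s)"
    and D': "\<And>s. s \<ge> x \<Longrightarrow> (D' has_real_derivative D'' s) (at s)"
    and D'': "\<And>s. s \<ge> x \<Longrightarrow> D s > 0 \<Longrightarrow> D'' s \<ge> c" and c: "c > 0"
    and start: "D x > 0" "D' x \<ge> 0"
  obtains s where "s \<ge> x" "D s > M"
proof -
  have cont: "continuous_on {x..y} D" "continuous_on {x..y} D'" for y
    by (rule DERIV_continuous_on[of _ _ D'] DERIV_continuous_on[of _ _ D''],
        use D D' in \<open>auto intro: has_field_derivative_at_within\<close>)+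
  have pos: "D s > 0" if s: "s \<ge> x" for s
  proof (rule ccontr)
    assume "\<not> D s > 0"
    then obtain z where z: "x < z" "z \<le> s" "D z = 0" "\<And>w. x \<le> w \<Longrightarrow> w < z \<Longrightarrow> D w > 0"
      using first_zero[OF cont(1)[of s] s start(1)] by auto
    have D'_nonneg: "D' w \<ge> 0" if w: "x \<le> w" "w < z" for w
    proof -
      have "D' x \<le> D' w"
      proof (rule DERIV_nonneg_imp_nondecreasing[OF w(1)])
        fix v assume v: "x \<le> v" "v \<le> w"
        then show "\<exists>y. (D' has_real_derivative y) (at v) \<and> 0 \<le> y"
          using D'[of v] D''[of v] z(4)[of v] w c by (intro exI[of _ "D'' v"]) auto
      qed
      then show ?thesis using start by linarith
    qed
    have "D x \<le> D z"
    proof (rule DERIV_nonneg_imp_increasing_open[of x z D])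
      fix v assume "x < v" "v < z"
      then show "\<exists>y. (D has_real_derivative y) (at v) \<and> 0 \<le> y"
        using D[of v] D'_nonneg[of v] by (intro exI[of _ "D' v"]) auto
    qed (use z cont in auto)
    then show False using z start by auto
  qed
  show thesis
    by (rule uniformly_convex_unbounded[OF D D', of x c])
      (use D'' pos c that in auto)
qed

text \<open>Boundedness forces \<open>D' < 0\<close> wherever \<open>D > 0\<close>. If positive
  values occurred arbitrarily late, going left from them would keep \<open>D\<close> positive on the
  whole half-line, where uniform convexity makes it unbounded.\<close>

lemma uniformly_convex_where_positive_eventually_nonpos:
  fixes D D' D'' :: "real \<Rightarrow> real"
  assumes D: "\<And>s. s \<ge> S \<Longrightarrow> (D has_real_derivative D' s) (at s)"
    and D': "\<And>s. s \<ge> S \<Longrightarrow> (D' has_real_derivative D'' s) (at s)"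
    and D'': "\<And>s. s \<ge> S \<Longrightarrow> D s > 0 \<Longrightarrow> D'' s \<ge> c" and c: "c > 0"
    and bound: "\<And>s. s \<ge> S \<Longrightarrow> D s \<le> M"
  shows "\<forall>\<^sub>F s in at_top. D s \<le> 0"
proof (rule ccontr)
  assume "\<not> ?thesis"
  then have often: "\<exists>s\<ge>T. D s > 0" for T
    unfolding eventually_at_top_linorder by (auto simp: not_le)
  have dec: "D' x < 0" if x: "x \<ge> S" "D x > 0" for x
  proof (rule ccontr)
    assume "\<not> D' x < 0"
    then obtain s where "s \<ge> x" "D s > M"
      using uniformly_convex_where_positive_unbounded[of x D D' D'' c M] D D' D'' c x by auto
    then show False using bound[of s] x by auto
  qed
  have pos: "D s > 0" if s: "s \<ge> S" for s
  proof (rule ccontr)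
    assume neg: "\<not> D s > 0"
    obtain s' where s': "s' \<ge> s" "D s' > 0" using often by blast
    have ss': "s < s'" using neg s' by (metis less_le)
    \<comment> \<open>Reflection turns the last zero before \<open>s'\<close> into a first
      zero.\<close>
    have "((\<lambda>t. D (- t)) has_real_derivative - D' (- t)) (at t)" if "t \<le> - s" for t
      using DERIV_mirror[THEN iffD1, OF D[of "- t"]] that s by auto
    then have "continuous_on {-s'..-s} (\<lambda>t. D (- t))"
      by (intro continuous_at_imp_continuous_on ballI DERIV_isCont) auto
    then obtain z where z: "- s' < z" "z \<le> - s" "D (- z) = 0"
      "\<And>w. - s' \<le> w \<Longrightarrow> w < z \<Longrightarrow> D (- w) > 0"
      using first_zero[of "- s'" "- s" "\<lambda>t. D (- t)"] s' neg ss' by auto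
    have "\<exists>y>-z. y < s' \<and> D s' - D (-z) = (s' - (-z)) * D' y"
      by (rule MVT2) (use z D s in auto)
    then obtain y where y: "y > - z" "y < s'" "D s' - D (-z) = (s' - (-z)) * D' y" by auto
    have "D' y < 0" using dec[of y] z(4)[of "- y"] y z(2) s by auto
    then have "(s' - (-z)) * D' y < 0" using z(1) by (intro mult_pos_neg) auto
    then show False using y(3) z(3) s'(2) by linarith
  qed
  obtain s where "s \<ge> S" "D s > M"
    using uniformly_convex_unbounded[of S D D' D'' c M] D D' D'' c pos by auto
  then show False using bound[of s] by auto
qed

section \<open>Explicit barriers\<close>

text \<open>For \<open>g > 0\<close> the cubic equation reads \<open>s = f g\<close> with
  \<open>f\<close> strictly decreasing, so \<open>g\<close> is the inverse of \<open>f\<close>. The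
  constant 2 outweighs the bound \<open>g'' \<le> 1\<close> when \<open>g\<close> and
  \<open>- g\<close> are used as barriers.\<close>

lemma cubic_barrier:
  obtains g g' g'' :: "real \<Rightarrow> real" where
    "\<And>s. g s > 0" "\<And>s. 2 * g s ^ 3 + s * g s = 2"
    "\<And>s. (g has_real_derivative g' s) (at s)" "\<And>s. (g' has_real_derivative g'' s) (at s)"
    "\<And>s. g'' s \<le> 1"
proof -
  define f :: "real \<Rightarrow> real" where "f = (\<lambda>x. 2 / x - 2 * x\<^sup>2)"
  have f_less: "f y < f x" if "0 < x" "x < y" for x y
  proof -
    have "2 / y < 2 / x" using that by (simp add: field_simps)
    moreover have "x\<^sup>2 < y\<^sup>2" using that by (intro power_strict_mono) auto
    ultimately show ?thesis by (simp add: f_def)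
  qed
  have f_inj: "x = y" if "f x = f y" "0 < x" "0 < y" for x y
    using f_less[of x y] f_less[of y x] that by (cases x y rule: linorder_cases) auto
  have f_isCont: "isCont f x" if "x > 0" for x
    unfolding f_def using that by (intro continuous_intros) auto
  have "\<exists>x>0. f x = s" for s
  proof -
    \<comment> \<open>Bracket for the intermediate value theorem:
      \<open>2 / x = 2 * \<bar>s\<bar> + 4\<close> dominates near zero, and
      \<open>- 2 * y\<^sup>2\<close> dominates at \<open>y\<close>.\<close>
    define x y where "x = 1 / (\<bar>s\<bar> + 2)" and "y = \<bar>s\<bar> + 2"
    have x: "0 < x" "x \<le> 1" by (auto simp: x_def)
    have "x\<^sup>2 \<le> 1" using x by (simp add: power_le_one)
    then have "f x \<ge> s" by (auto simp: f_def x_def)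
    moreover have "f y \<le> s"
    proof -
      have y: "y \<ge> 2" by (simp add: y_def)
      then have "2 / y \<le> 1" by simp
      moreover have "y * 1 \<le> y * y" using y by (intro mult_left_mono) auto
      ultimately have "f y \<le> 1 - 2 * y" by (simp add: f_def power2_eq_square)
      then show ?thesis unfolding y_def using abs_ge_minus_self[of s] by argo
    qed
    moreover have "x \<le> y" using x by (auto simp: y_def)
    ultimately have "\<exists>z\<ge>x. z \<le> y \<and> f z = s"
      using x by (intro IVT2) (auto intro!: f_isCont)
    then obtain z where "z \<ge> x" "f z = s" by blast
    then show ?thesis using x by (intro exI[of _ z]) auto
  qed
  then obtain g where g: "\<And>s. g s > 0" "\<And>s. f (g s) = s" by metis
  have gf: "g (f x) = x" if "x > 0" for x using f_inj[of "g (f x)" x] g that by auto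
  have g_isCont: "isCont g s" for s
  proof -
    have "isCont g (f (g s))"
      by (rule isCont_inverse_function2[of "g s / 2" _ "g s * 2"])
        (use g(1)[of s] in \<open>auto intro!: gf f_isCont\<close>)
    then show ?thesis by (simp add: g)
  qed
  \<comment> \<open>Implicit differentiation of the cubic equation, with \<open>s\<close> eliminated
    so that only \<open>g s\<close> remains.\<close>
  define g' where "g' = (\<lambda>s. - (g s)\<^sup>2 / (4 * g s ^ 3 + 2))"
  define g'' where "g'' = (\<lambda>s. g s ^ 3 * (4 - 4 * g s ^ 3) / (4 * g s ^ 3 + 2) ^ 3)"
  have pos: "4 * g s ^ 3 + 2 > 0" for s using g(1)[of s] by (simp add: add_pos_pos)
  have dg: "(g has_real_derivative g' s) (at s)" for s
  proof -
    have "(f has_real_derivative - 2 / (g s)\<^sup>2 - 4 * g s) (at (g s))"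
      unfolding f_def using g(1)[of s]
      by (auto intro!: derivative_eq_intros simp: power2_eq_square)
    moreover have "- 2 / (g s)\<^sup>2 - 4 * g s = - ((4 * g s ^ 3 + 2) / (g s)\<^sup>2)"
      using g(1)[of s] by (simp add: field_simps eval_nat_numeral)
    ultimately have "(g has_real_derivative inverse (- ((4 * g s ^ 3 + 2) / (g s)\<^sup>2))) (at s)"
      using pos[of s] g(1)[of s] g(2) g_isCont
      by (intro DERIV_inverse_function[where f = f and g = g and a = "s - 1" and b = "s + 1"]) auto
    then show ?thesis by (simp add: g'_def)
  qed
  have dg': "(g' has_real_derivative g'' s) (at s)" for s
  proof -
    define x where "x = g s"
    define N where "N = 4 * x ^ 3 + 2"
    define d where "d = g' s"
    have N: "N \<noteq> 0" using pos[of s] by (simp add: N_def x_def)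
    have "(g has_real_derivative d) (at s)" using dg by (simp add: d_def)
    then have "((\<lambda>s. (g s)\<^sup>2 / (4 * g s ^ 3 + 2)) has_real_derivative
        ((2 * x * d) * N - x\<^sup>2 * (4 * (3 * x\<^sup>2 * d))) / (N * N)) (at s)"
      using N by (auto intro!: derivative_eq_intros simp: N_def x_def field_simps)
    from DERIV_minus[OF this] have "(g' has_real_derivative
        - (((2 * x * g' s) * N - x\<^sup>2 * (4 * (3 * x\<^sup>2 * g' s))) / (N * N))) (at s)"
      unfolding d_def by (simp only: g'_def minus_divide_left)
    moreover have "- (((2 * x * g' s) * N - x\<^sup>2 * (4 * (3 * x\<^sup>2 * g' s))) / (N * N)) = g'' s"
    proof -
      have e: "g' s = - x\<^sup>2 / N" "g'' s = x ^ 3 * (4 - 4 * x ^ 3) / N ^ 3"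
        by (simp_all add: g'_def g''_def x_def N_def)
      have "- (((2 * x * g' s) * N - x\<^sup>2 * (4 * (3 * x\<^sup>2 * g' s))) / (N * N))
        = (2 * x ^ 3 * N - 12 * x ^ 6) / N ^ 3"
        unfolding e using N by (simp add: field_simps eval_nat_numeral)
      also have "2 * x ^ 3 * N - 12 * x ^ 6 = x ^ 3 * (4 - 4 * x ^ 3)"
        by (simp add: N_def algebra_simps eval_nat_numeral)
      finally show ?thesis by (simp add: e)
    qed
    ultimately show ?thesis by simp
  qed
  have "g'' s \<le> 1" for s
  proof -
    define x where "x = g s ^ 3"
    have x: "x > 0" using g(1)[of s] by (simp add: x_def)
    have "x * (4 - 4 * x) = 1 - (2 * x - 1)\<^sup>2" by (simp add: power2_eq_square algebra_simps)
    then have "x * (4 - 4 * x) \<le> 1" by (metis diff_le_eq le_add_same_cancel1 zero_le_power2)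
    also have "1 \<le> (4 * x + 2) ^ 3" using x by (intro one_le_power) auto
    finally show ?thesis using x by (simp add: g''_def flip: x_def)
  qed
  moreover have "2 * g s ^ 3 + s * g s = 2" for s
  proof -
    have "s * g s = f (g s) * g s" by (simp only: g(2))
    also have "\<dots> = 2 - 2 * g s ^ 3"
      using g(1)[of s] by (simp add: f_def left_diff_distrib eval_nat_numeral)
    finally show ?thesis by simp
  qed
  ultimately show thesis using that[of g g' g''] g dg dg' by blast
qed

lemma sqrt_half_deriv:
  assumes "s < 0"
  shows "((\<lambda>s. sqrt (- s / 2)) has_real_derivative - 1 / (4 * sqrt (- s / 2))) (at s)"
  using assms by (auto intro!: derivative_eq_intros simp: field_simps)

text \<open>The first-order WKB approximation of the Riccati equation \<open>y' + y\<^sup>2 + s / 2 = 0\<close>, whose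
  solutions are the Airy solutions of Painleve II with \<open>\<alpha> = - 1/2\<close>: the ansatz
  \<open>y = (ln (cosh \<theta> / sqrt b))'\<close> with \<open>\<theta>' = b\<close> and \<open>T = tanh \<theta>\<close> (or its limit \<open>T = 1\<close>) leaves
  the residual \<open>5 / (64 b\<^sup>4)\<close>.\<close>
lemma wkb_supersolution:
  fixes b T y y' y'' :: "real \<Rightarrow> real"
  assumes b_def: "b = (\<lambda>s. sqrt (- s / 2))"
    and dT: "\<And>s. s < 0 \<Longrightarrow> (T has_real_derivative b s * (1 - (T s)\<^sup>2)) (at s)"
    and T: "\<And>s. s < 0 \<Longrightarrow> \<bar>T s\<bar> \<le> 1"
    and \<kappa>: "\<kappa> > 0" "\<kappa> \<le> 1"
    and y_def: "y = (\<lambda>s. b s * T s + 1 / (8 * (b s)\<^sup>2))"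
    and y'_def: "y' = (\<lambda>s. 5 / (64 * b s ^ 4) - (y s)\<^sup>2 - s / 2)"
    and y''_def: "y'' = (\<lambda>s. 5 / (64 * b s ^ 6) - 2 * y s * y' s - 1 / 2)"
    and s: "s < 0"
  shows "(y has_real_derivative y' s) (at s)" "(y' has_real_derivative y'' s) (at s)"
    "b s ^ 3 \<ge> 1 / \<kappa> \<Longrightarrow> y'' s \<le> s * y s + 2 * y s ^ 3 - 1 / 2 + \<kappa> / 2"
proof -
  have b: "b s > 0" using s by (simp add: b_def)
  have b2: "s = - 2 * (b s)\<^sup>2" using s by (simp add: b_def)
  have db: "(b has_real_derivative - 1 / (4 * b s)) (at s)"
    unfolding b_def by (rule sqrt_half_deriv[OF s])
  show dy: "(y has_real_derivative y' s) (at s)"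
  proof -
    have "(y has_real_derivative
        - 1 / (4 * b s) * T s + b s * (b s * (1 - (T s)\<^sup>2)) + 1 / (16 * b s ^ 4)) (at s)"
      unfolding y_def using b
      by (auto intro!: derivative_eq_intros db dT[OF s] simp: field_simps eval_nat_numeral)
    moreover have "y' s = - 1 / (4 * b s) * T s + b s * (b s * (1 - (T s)\<^sup>2)) + 1 / (16 * b s ^ 4)"
    proof -
      have "y' s = 5 / (64 * b s ^ 4) - (b s * T s + 1 / (8 * (b s)\<^sup>2))\<^sup>2 + (b s)\<^sup>2"
        unfolding y'_def y_def using b2 by simp
      then show ?thesis using b by (simp add: field_simps eval_nat_numeral)
    qed
    ultimately show ?thesis by simp
  qed
  show "(y' has_real_derivative y'' s) (at s)"
    unfolding y'_def using b
    by (auto intro!: derivative_eq_intros db dy simp: y''_def y'_def[symmetric] field_simps eval_nat_numeral)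
  show "y'' s \<le> s * y s + 2 * y s ^ 3 - 1 / 2 + \<kappa> / 2" if b3: "b s ^ 3 \<ge> 1 / \<kappa>"
  proof -
    \<comment> \<open>Differentiating the exact Riccati equation gives Painleve II with
      \<open>- 1 / 2\<close>; the bracket is the contribution of the residual. Since
      \<open>y \<ge> - b\<close>, it is at most \<open>15 / 64 * x\<close> for the small parameter
      \<open>x = 1 / b\<^sup>3\<close>.\<close>
    have y''_eq: "y'' s = s * y s + 2 * y s ^ 3 - 1 / 2 + (5 / (64 * b s ^ 6) - 10 * y s / (64 * b s ^ 4))"
      unfolding y''_def y'_def by (simp add: algebra_simps eval_nat_numeral)
    define x where "x = 1 / b s ^ 3"
    have x: "0 < x" "x \<le> \<kappa>" using b b3 \<kappa> by (auto simp: x_def field_simps)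
    have "b s * (- 1) \<le> b s * T s" using T[OF s] b by (intro mult_left_mono) auto
    then have "y s \<ge> - b s" using b unfolding y_def by (smt (verit) zero_le_divide_1_iff zero_le_power2)
    then have "- 10 * y s / (64 * b s ^ 4) \<le> 10 * b s / (64 * b s ^ 4)"
      using b by (intro divide_right_mono) auto
    also have "\<dots> = 10 / 64 * x" using b by (simp add: x_def field_simps eval_nat_numeral)
    finally have "- (10 * y s / (64 * b s ^ 4)) \<le> 10 / 64 * x" by simp
    moreover have "5 / (64 * b s ^ 6) = 5 / 64 * (x * x)"
      by (simp add: x_def flip: power_add)
    moreover have "x * x \<le> 1 * x" using x \<kappa> by (intro mult_right_mono) auto
    ultimately show ?thesis using x unfolding y''_eq by linarith
  qed
qed

section \<open>Existence of the connecting solution\<close>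

lemma painleve2_solution_between:
  fixes lo up :: "real \<Rightarrow> real" and \<alpha> :: real
  defines "F \<equiv> \<lambda>s y. s * y + 2 * y ^ 3 + \<alpha>"
  assumes lo: "continuous_on UNIV lo" "\<And>s. subsolution_at F lo s"
    and up: "continuous_on UNIV up" "\<And>s. supersolution_at F up s"
    and lo_up: "\<And>s. lo s \<le> up s"
  obtains y y' where
    "\<And>s. (y has_real_derivative y' s) (at s)"
    "\<And>s. (y' has_real_derivative s * y s + 2 * y s ^ 3 + \<alpha>) (at s)"
    "\<And>s. lo s \<le> y s \<and> y s \<le> up s"
proof (rule solution_between_sub_and_supersolution[of F lo up])
  show "continuous_on UNIV (\<lambda>(s, y). F s y)"
    unfolding F_def case_prod_unfold by (intro continuous_intros)
  show "\<exists>K>0. \<forall>s x y. \<bar>s\<bar> \<le> N \<longrightarrow> - M \<le> x \<longrightarrow> x \<le> y \<longrightarrow> y \<le> M \<longrightarrow> F s y - F s x \<le> K * (y - x)" for N M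
  \<comment> \<open>From \<open>F s y - F s x = (s + 2 (x\<^sup>2 + x y + y\<^sup>2)) (y -
    x)\<close> and \<open>2 x y \<le> x\<^sup>2 + y\<^sup>2\<close>; the summand 1 makes the
    constant positive.\<close>
  proof (intro exI[of _ "\<bar>N\<bar> + 6 * M\<^sup>2 + 1"] conjI allI impI)
    fix s x y :: real
    assume *: "\<bar>s\<bar> \<le> N" "- M \<le> x" "x \<le> y" "y \<le> M"
    have "x\<^sup>2 \<le> M\<^sup>2" "y\<^sup>2 \<le> M\<^sup>2" using * by (auto intro!: abs_le_square_iff[THEN iffD1])
    moreover have "2 * (x * y) \<le> x\<^sup>2 + y\<^sup>2"
      using zero_le_power2[of "x - y"] by (simp add: power2_diff)
    moreover have "s \<le> \<bar>N\<bar>" using *(1) by linarith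
    ultimately have "s + 2 * (x\<^sup>2 + x * y + y\<^sup>2) \<le> \<bar>N\<bar> + 6 * M\<^sup>2 + 1" by argo
    then have "(s + 2 * (x\<^sup>2 + x * y + y\<^sup>2)) * (y - x) \<le> (\<bar>N\<bar> + 6 * M\<^sup>2 + 1) * (y - x)"
      using * by (intro mult_right_mono) auto
    moreover have "F s y - F s x = (s + 2 * (x\<^sup>2 + x * y + y\<^sup>2)) * (y - x)"
      unfolding F_def by (simp add: algebra_simps eval_nat_numeral)
    ultimately show "F s y - F s x \<le> (\<bar>N\<bar> + 6 * M\<^sup>2 + 1) * (y - x)" by simp
  qed (simp add: add_nonneg_pos)
qed (use lo up lo_up that in \<open>auto simp: F_def\<close>)

text \<open>Otherwise \<open>u\<close> stays above the barrier \<open>W\<close> near minus infinity.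
  There \<open>W\<close> is a supersolution with margin \<open>\<kappa> / 2\<close>, so
  \<open>u - W\<close> is uniformly convex and unbounded, against the upper bound on
  \<open>u\<close>.\<close>

lemma nonneg_solution_below_wkb:
  fixes u u' :: "real \<Rightarrow> real"
  assumes \<alpha>: "- 1 / 2 < \<alpha>" "\<alpha> < 0"
    and u: "\<And>s. (u has_real_derivative u' s) (at s)"
    and u': "\<And>s. (u' has_real_derivative s * u s + 2 * u s ^ 3 + \<alpha>) (at s)"
    and u_le: "\<And>s. s < 0 \<Longrightarrow> u s \<le> sqrt (- s / 2) + 1 / (- s)"
  obtains s where "s < 0" "sqrt (- s / 2) ^ 3 \<ge> 1 / (\<alpha> + 1 / 2)"
    "u s < sqrt (- s / 2) + 1 / (8 * (sqrt (- s / 2))\<^sup>2)"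
proof (rule ccontr)
  note witness = that
  assume neg: "\<not> thesis"
  define \<kappa> where "\<kappa> = \<alpha> + 1 / 2"
  have \<kappa>: "\<kappa> > 0" "\<kappa> \<le> 1" using \<alpha> by (auto simp: \<kappa>_def)
  define b where "b = (\<lambda>s. sqrt (- s / 2))"
  \<comment> \<open>For \<open>s \<le> - S\<close> this gives
    \<open>b s \<ge> 1 / \<kappa> \<ge> 1\<close>, hence the required bound on the cube.\<close>
  define S where "S = 2 * (1 / \<kappa>)\<^sup>2"
  define W where "W = (\<lambda>s. b s * 1 + 1 / (8 * (b s)\<^sup>2))"
  define W' where "W' = (\<lambda>s. 5 / (64 * b s ^ 4) - (W s)\<^sup>2 - s / 2)"
  define W'' where "W'' = (\<lambda>s. 5 / (64 * b s ^ 6) - 2 * W s * W' s - 1 / 2)"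
  have k1: "1 / \<kappa> \<ge> 1" using \<kappa> by simp
  then have "(1 / \<kappa>)\<^sup>2 \<ge> 1" by (rule one_le_power)
  then have S: "S \<ge> 2" unfolding S_def by linarith
  have b: "b s \<ge> 1 / \<kappa>" if "s \<le> - S" for s
  proof -
    have "(1 / \<kappa>)\<^sup>2 \<le> - s / 2" using that by (simp add: S_def)
    then show ?thesis unfolding b_def by (rule real_le_rsqrt)
  qed
  have b3: "b s ^ 3 \<ge> 1 / \<kappa>" if "s \<le> - S" for s
    using power_increasing[of 1 3 "b s"] b[OF that] k1 by simp
  have W: "(W has_real_derivative W' s) (at s)" "(W' has_real_derivative W'' s) (at s)"
    "W'' s \<le> s * W s + 2 * W s ^ 3 - 1 / 2 + \<kappa> / 2" if s: "s \<le> - S" for s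
  proof -
    have "s < 0" using s S by simp
    \<comment> \<open>The case \<open>T = 1\<close>, a constant solution of
      \<open>T' = b (1 - T\<^sup>2)\<close>.\<close>
    note * = wkb_supersolution[OF b_def _ _ \<kappa> W_def W'_def W''_def this]
    show "(W has_real_derivative W' s) (at s)" "(W' has_real_derivative W'' s) (at s)"
      "W'' s \<le> s * W s + 2 * W s ^ 3 - 1 / 2 + \<kappa> / 2"
      by (rule *; use b3[OF s] in simp)+
  qed
  have uW: "u s \<ge> W s" if "s \<le> - S" for s
  proof (rule ccontr)
    assume "\<not> u s \<ge> W s"
    then have thesis
      using b3[OF that] that S by (intro witness[of s]) (auto simp: W_def b_def \<kappa>_def)
    with neg show False ..
  qed
  \<comment> \<open>The difference of the cubics has the factor
    \<open>s + 2 (u\<^sup>2 + u W + W\<^sup>2)\<close>, nonnegative because \<open>W \<ge> b\<close>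
    and \<open>2 b\<^sup>2 = - s\<close>.\<close>
  have convex: "(s * u s + 2 * u s ^ 3 + \<alpha>) - W'' s \<ge> \<kappa> / 2" if s: "s \<le> - S" for s
  proof -
    have bs: "b s > 0" using b[OF s] k1 by linarith
    have "W s \<ge> b s" using bs by (simp add: W_def)
    then have w: "(W s)\<^sup>2 \<ge> (b s)\<^sup>2" "W s > 0" using bs by (auto intro: power_mono)
    have "(b s)\<^sup>2 = - s / 2" using s S by (simp add: b_def)
    moreover have "u s ^ 2 + u s * W s \<ge> 0" using uW[OF s] w(2) by simp
    ultimately have "s + 2 * (u s ^ 2 + u s * W s + (W s)\<^sup>2) \<ge> 0"
      using w(1) unfolding distrib_left by linarith
    then have "0 \<le> (u s - W s) * (s + 2 * (u s ^ 2 + u s * W s + (W s)\<^sup>2))"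
      using uW[OF s] by simp
    also have "\<dots> = s * u s + 2 * u s ^ 3 - (s * W s + 2 * W s ^ 3)"
      by (simp add: algebra_simps eval_nat_numeral)
    finally show ?thesis using W(3)[OF s] unfolding \<kappa>_def by argo
  qed
  obtain t where t: "t \<ge> S" "u (- t) - W (- t) > 1"
  proof (rule uniformly_convex_unbounded[of S "\<lambda>t. u (- t) - W (- t)" "\<lambda>t. - (u' (- t) - W' (- t))"
        "\<lambda>t. (- t * u (- t) + 2 * u (- t) ^ 3 + \<alpha>) - W'' (- t)" "\<kappa> / 2" 1])
    fix t assume t: "S \<le> t"
    show "((\<lambda>t. u (- t) - W (- t)) has_real_derivative - (u' (- t) - W' (- t))) (at t)"
      using DERIV_mirror[THEN iffD1, OF DERIV_diff[OF u W(1)]] t by simp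
    have "((\<lambda>t. u' (- t) - W' (- t)) has_real_derivative
       - (- t * u (- t) + 2 * u (- t) ^ 3 + \<alpha> - W'' (- t))) (at t)"
      using DERIV_mirror[THEN iffD1, OF DERIV_diff[OF u' W(2)]] t by simp
    from DERIV_minus[OF this]
    show "((\<lambda>t. - (u' (- t) - W' (- t))) has_real_derivative
       (- t * u (- t) + 2 * u (- t) ^ 3 + \<alpha>) - W'' (- t)) (at t)" by simp
    show "\<kappa> / 2 \<le> (- t * u (- t) + 2 * u (- t) ^ 3 + \<alpha>) - W'' (- t)"
      using convex[of "- t"] t by simp
  qed (use \<kappa> in auto)
  have "u (- t) \<le> b (- t) + 1 / t" using u_le[of "- t"] t S by (simp add: b_def)
  moreover have "W (- t) \<ge> b (- t)" by (simp add: W_def)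
  moreover have "1 / t \<le> 1" using t S by simp
  ultimately show False using t by linarith
qed

text \<open>The bounds \<open>- g \<le> Y \<le> g\<close> give the estimates on the right and the
  lower estimate on the left; the upper estimate on the left comes from
  \<open>Y \<le> v\<close>.\<close>

lemma connecting_solution_exists:
  fixes \<alpha> :: real
  assumes \<alpha>: "- 1 / 2 < \<alpha>" "\<alpha> < 0"
  obtains Y Y' s\<^sub>0 M where
    "\<And>s. (Y has_real_derivative Y' s) (at s)"
    "\<And>s. (Y' has_real_derivative s * Y s + 2 * Y s ^ 3 + \<alpha>) (at s)"
    "\<And>s. s \<ge> 0 \<Longrightarrow> \<bar>Y s\<bar> \<le> 1" "\<And>s. s > 0 \<Longrightarrow> \<bar>Y s\<bar> \<le> 2 / s"
    "s\<^sub>0 < 0" "\<And>s. s \<le> s\<^sub>0 \<Longrightarrow> \<bar>Y s + sqrt (- s / 2)\<bar> \<le> M / (- s)"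
proof -
  define \<kappa> where "\<kappa> = \<alpha> + 1 / 2"
  have \<kappa>: "\<kappa> > 0" "\<kappa> \<le> 1" using \<alpha> by (auto simp: \<kappa>_def)
  define F where "F = (\<lambda>s y. s * y + 2 * y ^ 3 + \<alpha>)"
  define b where "b = (\<lambda>s. sqrt (- s / 2))"
  have b2: "(b s)\<^sup>2 = - s / 2" if "s < 0" for s using that by (simp add: b_def)
  have bpos: "b s > 0" if "s < 0" for s using that by (simp add: b_def)
  obtain g g' g'' where g: "\<And>s. g s > 0" "\<And>s. 2 * g s ^ 3 + s * g s = 2"
    "\<And>s. (g has_real_derivative g' s) (at s)" "\<And>s. (g' has_real_derivative g'' s) (at s)"
    "\<And>s. g'' s \<le> 1" using cubic_barrier by blast
  have g_cont: "continuous_on UNIV g" by (rule DERIV_continuous_on[OF g(3)])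
  have g_super: "supersolution_at F g s" for s
  proof (rule supersolution_atI[of _ g' _ "g'' s"])
    show "g'' s \<le> F s (g s)" using g(2)[of s] g(5)[of s] \<alpha> unfolding F_def by linarith
  qed (use g in auto)
  have g_sub: "subsolution_at F (\<lambda>s. - g s) s" for s
  proof (rule subsolution_atI[of _ "\<lambda>s. - g' s" _ "- g'' s"])
    have "F s (- g s) = \<alpha> - 2" using g(2)[of s] by (simp add: F_def)
    then show "- g'' s \<ge> F s (- g s)" using g(5)[of s] \<alpha> by linarith
  qed (use g in \<open>auto intro!: always_eventually DERIV_minus\<close>)
  have g_le_1: "g s \<le> 1" if "s \<ge> 0" for s
  proof (rule ccontr)
    assume "\<not> g s \<le> 1"
    then have "g s ^ 3 > 1" by (intro one_less_power) auto
    then show False using g(2)[of s] mult_nonneg_nonneg[OF that less_imp_le[OF g(1)[of s]]] by linarith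
  qed
  have g_le_right: "g s \<le> 2 / s" if "s > 0" for s
  proof -
    have "s * g s \<le> 2" using g(2)[of s] g(1)[of s] zero_less_power[of "g s" 3] by linarith
    then show ?thesis using that by (simp add: field_simps)
  qed
  have g_ge_b: "g s \<ge> b s" and g_le_left: "g s \<le> b s + 1 / (- s)" if s: "s < 0" for s
  proof -
    have "g s * ((g s)\<^sup>2 - (b s)\<^sup>2) = 1"
      using g(2)[of s] b2[OF s] by (simp add: algebra_simps eval_nat_numeral)
    then have eq: "g s * (g s + b s) * (g s - b s) = 1"
      by (simp add: algebra_simps power2_eq_square)
    have gb: "g s * (g s + b s) > 0" using g(1)[of s] bpos[OF s] by (simp add: add_pos_pos)
    show ge: "g s \<ge> b s"
    proof (rule ccontr)
      assume "\<not> g s \<ge> b s"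
      then have "g s * (g s + b s) * (g s - b s) < 0" using gb by (intro mult_pos_neg) auto
      then show False using eq by linarith
    qed
    have "b s * (b s + b s) \<le> g s * (g s + b s)"
      using ge bpos[OF s] by (intro mult_mono) auto
    then have "- s \<le> g s * (g s + b s)" using b2[OF s] by (simp add: power2_eq_square)
    then have "- s * (g s - b s) \<le> 1"
      using mult_right_mono[of "- s" "g s * (g s + b s)" "g s - b s"] ge eq by linarith
    then show "g s \<le> b s + 1 / (- s)" using s by (simp add: field_simps)
  qed
  obtain u u' where u: "\<And>s. (u has_real_derivative u' s) (at s)"
    "\<And>s. (u' has_real_derivative s * u s + 2 * u s ^ 3 + \<alpha>) (at s)"
    "\<And>s. 0 \<le> u s \<and> u s \<le> g s"
  proof (rule painleve2_solution_between[of "\<lambda>_. 0" \<alpha> g, folded F_def])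
    show "subsolution_at F (\<lambda>_. 0) s" for s
      by (rule subsolution_atI[of _ "\<lambda>_. 0" _ 0]) (use \<alpha> in \<open>auto simp: F_def\<close>)
  qed (use g g_super g_cont in \<open>auto simp: less_imp_le\<close>)
  have u_isCont: "isCont u s" for s using u(1) by (rule DERIV_isCont)
  obtain s2 where s2: "s2 < 0" "b s2 ^ 3 \<ge> 1 / \<kappa>" "u s2 < b s2 + 1 / (8 * (b s2)\<^sup>2)"
    unfolding b_def \<kappa>_def
  proof (rule nonneg_solution_below_wkb[OF \<alpha> u(1,2)])
    show "u s \<le> sqrt (- s / 2) + 1 / (- s)" if "s < 0" for s
      using u(3)[of s] g_le_left[OF that] by (simp add: b_def)
  qed
  \<comment> \<open>Since \<open>tanh\<close> tends to 1, the strict inequality at \<open>s2\<close>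
    survives at a finite phase; \<open>C\<close> below is the shift that gives \<open>v\<close> the
    phase \<open>\<theta>\<close> at \<open>s2\<close>.\<close>
  obtain \<theta> where \<theta>: "u s2 < b s2 * tanh \<theta> + 1 / (8 * (b s2)\<^sup>2)"
  proof -
    have "((\<lambda>\<theta>. b s2 * tanh \<theta> + 1 / (8 * (b s2)\<^sup>2)) \<longlongrightarrow> b s2 * 1 + 1 / (8 * (b s2)\<^sup>2)) at_top"
      by (intro tendsto_intros tanh_real_at_top)
    then have "\<forall>\<^sub>F \<theta> in at_top. u s2 < b s2 * tanh \<theta> + 1 / (8 * (b s2)\<^sup>2)"
      by (rule order_tendstoD) (use s2 in simp)
    then show thesis using that eventually_happens[of _ "at_top :: real filter"] by auto
  qed
  define C where "C = \<theta> + 4 / 3 * b s2 ^ 3"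
  define T where "T = (\<lambda>s. tanh (C - 4 / 3 * b s ^ 3))"
  define v where "v = (\<lambda>s. b s * T s + 1 / (8 * (b s)\<^sup>2))"
  define v' where "v' = (\<lambda>s. 5 / (64 * b s ^ 4) - (v s)\<^sup>2 - s / 2)"
  define v'' where "v'' = (\<lambda>s. 5 / (64 * b s ^ 6) - 2 * v s * v' s - 1 / 2)"
  have dT: "(T has_real_derivative b s * (1 - (T s)\<^sup>2)) (at s)" if s: "s < 0" for s
  proof -
    have "(b has_real_derivative - 1 / (4 * b s)) (at s)"
      unfolding b_def by (rule sqrt_half_deriv[OF s])
    then show ?thesis
      unfolding T_def using bpos[OF s]
      by (auto intro!: derivative_eq_intros simp: field_simps eval_nat_numeral)
  qed
  have T1: "\<bar>T s\<bar> \<le> 1" for s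
    unfolding T_def using tanh_real_lt_1 tanh_real_gt_neg1 by (smt (verit) abs_le_iff)
  have v: "(v has_real_derivative v' s) (at s)" "(v' has_real_derivative v'' s) (at s)"
    "b s ^ 3 \<ge> 1 / \<kappa> \<Longrightarrow> v'' s \<le> s * v s + 2 * v s ^ 3 - 1 / 2 + \<kappa> / 2" if s: "s < 0" for s
    using wkb_supersolution[OF b_def dT T1 \<kappa> v_def v'_def v''_def s] by blast+
  have v_s2: "u s2 < v s2" using \<theta> by (simp add: v_def T_def C_def)
  have v_super: "supersolution_at F v s" if s: "s < s2" for s
  proof (rule supersolution_atI[of _ v' _ "v'' s"])
    have s0: "s < 0" using s s2 by auto
    have "\<forall>\<^sub>F x in nhds s. x < 0" using s0 by (intro eventually_nhds_in_open[of "{..<0}", simplified]) auto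
    then show "\<forall>\<^sub>F x in nhds s. (v has_real_derivative v' x) (at x)"
      by eventually_elim (rule v)
    show "(v' has_real_derivative v'' s) (at s)" by (rule v(2)[OF s0])
    have "b s2 \<le> b s" using s by (simp add: b_def)
    then have b3: "b s ^ 3 \<ge> 1 / \<kappa>"
      using s2(2) bpos[OF s2(1)] power_mono[of "b s2" "b s" 3] by linarith
    show "v'' s \<le> F s (v s)" using v(3)[OF s0 b3] \<kappa> unfolding F_def \<kappa>_def by argo
  qed
  \<comment> \<open>As \<open>v > u\<close> at \<open>s2\<close>, the function \<open>up\<close>
    coincides with \<open>u\<close> near \<open>s2\<close>, so the gluing is continuous. To the left
    of \<open>s2\<close> the lower bound on \<open>b\<^sup>3\<close> persists and \<open>v\<close>
    is a supersolution.\<close>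
  define up where "up = (\<lambda>s. if s < s2 then min (v s) (u s) else u s)"
  have up_cont: "isCont up s" for s
  proof (cases s s2 rule: linorder_cases)
    case less
    then have "\<forall>\<^sub>F x in nhds s. x < s2" by (intro eventually_nhds_in_open[of "{..<s2}", simplified]) auto
    then have "\<forall>\<^sub>F x in nhds s. up x = min (v x) (u x)" by eventually_elim (simp add: up_def)
    moreover have "isCont (\<lambda>x. min (v x) (u x)) s"
      using DERIV_isCont[OF v(1)] less s2 u_isCont by (intro continuous_min) auto
    ultimately show ?thesis by (simp add: isCont_cong)
  next
    case equal
    have "isCont v s" using DERIV_isCont[OF v(1)] equal s2 by auto
    then have "isCont (\<lambda>x. v x - u x) s" using u_isCont by (intro continuous_intros)
    then have "((\<lambda>x. v x - u x) \<longlongrightarrow> v s - u s) (nhds s)"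
      using tendsto_at_iff_tendsto_nhds[of "\<lambda>x. v x - u x" s] by (simp add: isCont_def)
    then have "\<forall>\<^sub>F x in nhds s. 0 < v x - u x"
      by (rule order_tendstoD) (use v_s2 equal in simp)
    then have "\<forall>\<^sub>F x in nhds s. up x = u x" by eventually_elim (simp add: up_def)
    then show ?thesis using u_isCont by (simp add: isCont_cong)
  next
    case greater
    then have "\<forall>\<^sub>F x in nhds s. x > s2" by (intro eventually_nhds_in_open[of "{s2<..}", simplified]) auto
    then have "\<forall>\<^sub>F x in nhds s. up x = u x" by eventually_elim (simp add: up_def)
    then show ?thesis using u_isCont by (simp add: isCont_cong)
  qed
  have u_super: "supersolution_at F u s" for s
    by (rule supersolution_atI[of _ u']) (use u in \<open>auto simp: F_def\<close>)
  have up_super: "supersolution_at F up s" for s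
  proof (cases "up s = u s")
    case True
    show ?thesis by (rule supersolution_at_touch[of F u s up, OF u_super True]) (simp add: up_def)
  next
    case False
    then have s: "s < s2" "up s = v s" by (auto simp: up_def min_def split: if_splits)
    have "\<forall>\<^sub>F x in nhds s. x < s2" using s by (intro eventually_nhds_in_open[of "{..<s2}", simplified]) auto
    then have "\<forall>\<^sub>F x in nhds s. up x \<le> v x" by eventually_elim (simp add: up_def)
    then show ?thesis by (rule supersolution_at_touch[of F v s up, OF v_super[OF s(1)] s(2)])
  qed
  have lo_up: "- g s \<le> up s" for s
  proof -
    have "- g s \<le> u s" using u(3)[of s] g(1)[of s] by linarith
    moreover have "- g s \<le> v s" if "s < s2"
    proof -
      have s: "s < 0" using that s2 by simp
      have "b s * (- 1) \<le> b s * T s" using T1[of s] bpos[OF s] by (intro mult_left_mono) auto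
      moreover have "1 / (8 * (b s)\<^sup>2) \<ge> 0" by simp
      ultimately show ?thesis using g_ge_b[OF s] unfolding v_def by linarith
    qed
    ultimately show ?thesis by (simp add: up_def)
  qed
  obtain Y Y' where Y: "\<And>s. (Y has_real_derivative Y' s) (at s)"
    "\<And>s. (Y' has_real_derivative s * Y s + 2 * Y s ^ 3 + \<alpha>) (at s)"
    "\<And>s. - g s \<le> Y s \<and> Y s \<le> up s"
    by (rule painleve2_solution_between[of "\<lambda>s. - g s" \<alpha> up, folded F_def])
      (use continuous_on_minus[OF g_cont] g_sub up_super lo_up up_cont in
        \<open>auto intro: continuous_at_imp_continuous_on\<close>)
  have up_u: "up s \<le> u s" for s by (simp add: up_def)
  have Yg: "\<bar>Y s\<bar> \<le> g s" for s
    using Y(3)[of s] u(3)[of s] up_u[of s] by linarith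
  \<comment> \<open>The 1 covers the algebraic term \<open>1 / (8 b\<^sup>2)\<close>; the
    exponential covers \<open>b (1 + T)\<close>, using \<open>x * exp (- x) \<le> 1\<close>.\<close>
  define M where "M = 1 + 3 / 2 * exp (2 * C)"
  show thesis
  \<comment> \<open>Shifted by 1 because the definition of \<open>up\<close> brings in
    \<open>v\<close> only strictly to the left of \<open>s2\<close>.\<close>
  proof (rule that[of Y Y' "s2 - 1" M])
    show "\<bar>Y s\<bar> \<le> 1" if "s \<ge> 0" for s using Yg[of s] g_le_1[OF that] by linarith
    show "\<bar>Y s\<bar> \<le> 2 / s" if "s > 0" for s using Yg[of s] g_le_right[OF that] by linarith
    fix s assume "s \<le> s2 - 1"
    then have s: "s < s2" "s < 0" using s2 by auto
    define x where "x = 8 / 3 * b s ^ 3"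
    have x: "x > 0" using bpos[OF s(2)] by (simp add: x_def)
    have "1 + T s = 2 * exp (2 * C - x) / (1 + exp (2 * C - x))"
    proof -
      have eq: "exp (- 2 * (C - 4 / 3 * b s ^ 3)) = 1 / exp (2 * C - x)"
        by (simp add: x_def exp_minus[symmetric] flip: inverse_eq_divide)
      have "1 + (1 - 1 / E) / (1 + 1 / E) = 2 * E / (1 + E)" if "E > 0" for E :: real
      proof -
        have "(1 - 1 / E) / (1 + 1 / E) = (E * (1 - 1 / E)) / (E * (1 + 1 / E))"
          using that by simp
        also have "\<dots> = (E - 1) / (E + 1)"
          using that by (simp only: right_diff_distrib distrib_left) simp
        finally show ?thesis using that by (simp add: field_simps)
      qed
      from this[of "exp (2 * C - x)"] show ?thesis
        unfolding T_def tanh_real_altdef eq by simp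
    qed
    also have "\<dots> \<le> 2 * exp (2 * C - x) / 1" by (intro divide_left_mono) (auto simp: add_pos_pos)
    finally have "b s * (1 + T s) \<le> b s * (2 * exp (2 * C - x))"
      using bpos[OF s(2)] by (intro mult_left_mono) auto
    also have "\<dots> = 2 * exp (2 * C) * (b s * exp (- x))" by (simp add: exp_diff exp_minus field_simps)
    also have "b s * exp (- x) \<le> 3 / 4 / (- s)"
    proof -
      have "x * exp (- x) \<le> 1"
      proof -
        have "x \<le> exp x" using exp_ge_add_one_self[of x] by linarith
        then show ?thesis by (simp add: exp_minus field_simps)
      qed
      moreover have "x = 4 / 3 * (- s) * b s"
        using b2[OF s(2)] by (simp add: x_def power3_eq_cube power2_eq_square)
      ultimately have "4 / 3 * (- s) * w \<le> 1" if "w = b s * exp (- x)" for w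
        unfolding that by (metis mult.assoc)
      then have "4 / 3 * (- s) * (b s * exp (- x)) \<le> 1" by blast
      then have "b s * exp (- x) * (- s) \<le> 3 / 4" by (simp add: field_simps)
      then show ?thesis using s by (subst pos_le_divide_eq) auto
    qed
    finally have "b s * (1 + T s) \<le> 3 / 2 * exp (2 * C) / (- s)" by simp
    moreover have "1 / (8 * (b s)\<^sup>2) \<le> 1 / (- s)"
      using s b2[OF s(2)] by (intro divide_left_mono) (auto simp: mult_neg_neg)
    moreover have "v s + b s = b s * (1 + T s) + 1 / (8 * (b s)\<^sup>2)" by (simp add: v_def algebra_simps)
    ultimately have "v s + b s \<le> M / (- s)" by (simp add: M_def add_divide_distrib)
    moreover have "Y s \<le> v s" using Y(3)[of s] s by (simp add: up_def)
    moreover have "- Y s \<le> b s + 1 / (- s)" using Y(3)[of s] g_le_left[OF s(2)] by linarith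
    moreover have "1 / (- s) \<le> M / (- s)" using s by (intro divide_right_mono) (auto simp: M_def)
    ultimately show "\<bar>Y s + sqrt (- s / 2)\<bar> \<le> M / (- s)" unfolding b_def by linarith
  qed (use Y s2 in auto)
qed

section \<open>Qualitative properties of the connecting solution\<close>

text \<open>The part of the energy difference without a sign is the total derivative
  \<open>R'\<close>, whose integral over the support vanishes; the rest is pointwise
  nonnegative.\<close>

lemma energy_minimizing_of_riccati_defect_nonneg:
  fixes Y Y' :: "real \<Rightarrow> real"
  assumes Y: "\<And>s. (Y has_real_derivative Y' s) (at s)"
    and Y': "\<And>s. (Y' has_real_derivative s * Y s + 2 * Y s ^ 3 + \<alpha>) (at s)"
    and p: "\<And>s. Y' s + (Y s)\<^sup>2 + s / 2 \<ge> 0"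
  shows "energy_minimizing \<alpha> Y"
  unfolding energy_minimizing_def
proof (intro allI impI)
  fix \<phi> assume \<phi>: "test_function \<phi>"
  define \<phi>' where "\<phi>' = deriv \<phi>"
  have d\<phi>: "(\<phi> has_real_derivative \<phi>' s) (at s)" for s
    using \<phi>[unfolded test_function_def, THEN conjunct1, rule_format, of 0 s]
    by (simp add: \<phi>'_def DERIV_deriv_iff_real_differentiable)
  have "\<phi>' differentiable (at s)" for s
    using \<phi>[unfolded test_function_def, THEN conjunct1, rule_format, of 1 s] by (simp add: \<phi>'_def)
  then have c\<phi>': "continuous_on A \<phi>'" for A
    by (meson continuous_at_imp_continuous_on differentiable_imp_continuous_within)
  have c\<phi>: "continuous_on A \<phi>" and cY: "continuous_on A Y" and cY': "continuous_on A Y'" for A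
    by (rule DERIV_continuous_on, rule has_field_derivative_at_within, rule d\<phi> Y Y')+
  define S where "S = supp \<phi>"
  have S: "compact S" using \<phi> by (simp add: test_function_def S_def)
  define e where "e = (\<lambda>u u' s. 1/2 * (u' s)\<^sup>2 + 1/2 * s * (u s)\<^sup>2 + 1/2 * u s ^ 4 + \<alpha> * u s :: real)"
  define E1 where "E1 = e Y Y'"
  define E2 where "E2 = e (\<lambda>s. Y s + \<phi> s) (\<lambda>s. Y' s + \<phi>' s)"
  have dY: "deriv Y = Y'" and dY\<phi>: "deriv (\<lambda>s. Y s + \<phi> s) = (\<lambda>s. Y' s + \<phi>' s)"
    by (auto intro!: DERIV_imp_deriv DERIV_add Y d\<phi>)
  \<comment> \<open>\<open>Y' \<phi>\<close> absorbs the first variation through the equation; the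
    other two terms cancel the mixed products \<open>2 Y \<phi> \<phi>'\<close> and
    \<open>\<phi>\<^sup>2 \<phi>'\<close> of the completed square.\<close>
  define R where "R = (\<lambda>s. Y' s * \<phi> s - Y s * \<phi> s ^ 2 - \<phi> s ^ 3 / 3)"
  define R' where "R' = (\<lambda>s. (s * Y s + 2 * Y s ^ 3 + \<alpha>) * \<phi> s + Y' s * \<phi>' s
      - (Y' s * \<phi> s ^ 2 + 2 * Y s * \<phi> s * \<phi>' s) - \<phi> s ^ 2 * \<phi>' s)"
  have dR: "(R has_real_derivative R' s) (at s)" for s
    unfolding R_def R'_def
    by (auto intro!: derivative_eq_intros Y Y' d\<phi> simp: field_simps power2_eq_square)
  have cont: "continuous_on A E1" "continuous_on A E2" "continuous_on A R'" for A
    unfolding E1_def E2_def R'_def e_def by (intro continuous_intros cY cY' c\<phi> c\<phi>')+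
  have int: "set_integrable lborel S f" if "\<And>A. continuous_on A f" for f :: "real \<Rightarrow> real"
    unfolding set_integrable_def by (rule borel_integrable_compact[OF S that])
  have "R' s \<le> E2 s - E1 s" for s
  proof -
    have "E2 s - E1 s - R' s = (Y' s + (Y s)\<^sup>2 + s / 2) * (\<phi> s)\<^sup>2
        + 1/2 * (\<phi>' s + 2 * Y s * \<phi> s + (\<phi> s)\<^sup>2)\<^sup>2"
      unfolding E1_def E2_def R'_def e_def
      by (simp add: algebra_simps power2_eq_square power3_eq_cube power4_eq_xxxx)
    moreover have "\<dots> \<ge> 0" using p[of s] by simp
    ultimately show ?thesis by linarith
  qed
  then have "(LINT s:S|lborel. R' s) \<le> (LINT s:S|lborel. E2 s - E1 s)"
    by (intro set_integral_mono set_integral_diff int cont)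
  also have "\<dots> = (LINT s:S|lborel. E2 s) - (LINT s:S|lborel. E1 s)"
    by (intro set_integral_diff int cont)
  finally have le: "(LINT s:S|lborel. R' s) \<le> (LINT s:S|lborel. E2 s) - (LINT s:S|lborel. E1 s)" .
  \<comment> \<open>\<open>supp \<phi>\<close> need not be an interval; integrating \<open>R'\<close> over it is harmless since \<open>R'\<close> vanishes outside.\<close>
  have out: "\<phi> s = 0 \<and> \<phi>' s = 0" if "s \<notin> S" for s
  proof -
    have S_eq: "S = closure {s. \<phi> s \<noteq> 0}" by (simp add: S_def supp_def)
    have "\<forall>\<^sub>F x in nhds s. x \<in> - S"
      using that by (intro eventually_nhds_in_open) (auto simp: S_eq)
    then have "\<forall>\<^sub>F x in nhds s. \<phi> x = 0"
    proof eventually_elim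
      case (elim x)
      then show ?case using closure_subset[of "{s. \<phi> s \<noteq> 0}"] by (auto simp: S_eq)
    qed
    then have "(\<phi> has_real_derivative 0) (at s)"
      using DERIV_cong_ev[OF refl _ refl, of \<phi> "\<lambda>_. 0" s 0] by simp
    then show ?thesis
      using DERIV_unique[OF d\<phi>] eventually_nhds_x_imp_x[OF \<open>\<forall>\<^sub>F x in nhds s. \<phi> x = 0\<close>] by auto
  qed
  \<comment> \<open>The strict bound keeps both endpoints outside \<open>S\<close>, so that
    \<open>R\<close> vanishes there.\<close>
  obtain r where r: "r > 0" "\<And>s. s \<in> S \<Longrightarrow> \<bar>s\<bar> < r"
    using compact_imp_bounded[OF S] unfolding bounded_pos_less by auto
  have "(LINT s:S|lborel. R' s) = (LINT s|lborel. indicator {-r..r} s *\<^sub>R R' s)"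
    unfolding set_lebesgue_integral_def
  proof (rule Bochner_Integration.integral_cong[OF refl])
    fix s show "indicator S s *\<^sub>R R' s = indicator {-r..r} s *\<^sub>R R' s"
      using out[of s] r(2)[of s] by (cases "s \<in> S") (auto simp: R'_def indicator_def)
  qed
  also have "\<dots> = R r - R (- r)"
    by (rule integral_FTC_atLeastAtMost)
      (use r dR cont in \<open>auto simp flip: has_real_derivative_iff_has_vector_derivative
        intro: has_field_derivative_at_within\<close>)
  also have "\<dots> = 0"
  proof -
    have "r \<notin> S" "- r \<notin> S" using r by force+
    then show ?thesis using out by (auto simp: R_def)
  qed
  finally have "(LINT s:S|lborel. E1 s) \<le> (LINT s:S|lborel. E2 s)" using le by simp
  then show "painleve2_energy \<alpha> (supp \<phi>) Y \<le> painleve2_energy \<alpha> (supp \<phi>) (\<lambda>s. Y s + \<phi> s)"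
    unfolding painleve2_energy_def dY dY\<phi> by (simp add: E1_def E2_def e_def S_def)
qed

text \<open>At a zero of \<open>p\<close> the derivative is \<open>\<alpha> + 1 / 2 > 0\<close>, so
  a negative value persists to the left and is amplified where \<open>Y \<le> - 1\<close>. Then
  \<open>Y'\<close> becomes so negative that \<open>Y\<close> rises above \<open>- 1\<close> on the
  way to the left.\<close>

lemma riccati_defect_nonneg:
  fixes Y Y' :: "real \<Rightarrow> real"
  assumes Y: "\<And>s. (Y has_real_derivative Y' s) (at s)"
    and Y': "\<And>s. (Y' has_real_derivative s * Y s + 2 * Y s ^ 3 + \<alpha>) (at s)"
    and \<alpha>: "- 1 / 2 < \<alpha>"
    and left: "\<And>s. s \<le> s\<^sub>0 \<Longrightarrow> Y s \<le> - 1"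
  shows "Y' s + (Y s)\<^sup>2 + s / 2 \<ge> 0"
proof (rule ccontr)
  define p where "p = (\<lambda>s. Y' s + (Y s)\<^sup>2 + s / 2)"
  assume "\<not> ?thesis"
  then have ps: "p s < 0" by (simp add: p_def)
  have dp: "(p has_real_derivative 2 * Y s * p s + (\<alpha> + 1 / 2)) (at s)" for s
    unfolding p_def
    by (auto intro!: derivative_eq_intros Y Y' simp: algebra_simps power2_eq_square power3_eq_cube)
  have neg: "p x < 0" if "x \<le> s" for x
  proof (rule ccontr)
    assume *: "\<not> p x < 0"
    then have "x < s" using ps that by (metis less_le)
    then have "p s > 0"
      by (rule no_down_crossing[of x s p, OF dp]) (use * \<alpha> in auto)
    then show False using ps by simp
  qed
  define S where "S = min s s\<^sub>0"
  \<comment> \<open>\<open>exp (2 * x)\<close> is the integrating factor for the rate at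
    \<open>Y = - 1\<close>; since \<open>p < 0\<close> and \<open>Y + 1 \<le> 0\<close>, the product
    \<open>- p x * exp (2 * x)\<close> is nonincreasing.\<close>
  define \<rho> where "\<rho> = - p S * exp (2 * S)"
  have \<rho>: "\<rho> > 0" using neg[of S] by (simp add: \<rho>_def S_def mult_neg_pos)
  have grow: "- p x * exp (2 * x) \<ge> \<rho>" if x: "x \<le> S" for x
    unfolding \<rho>_def
  proof (rule DERIV_nonpos_imp_nonincreasing[OF x])
    fix z assume z: "x \<le> z" "z \<le> S"
    have "p z * (Y z + 1) \<ge> 0"
      using neg[of z] left[of z] z by (intro mult_nonpos_nonpos) (auto simp: S_def)
    then have le: "(- 2 * (p z * (Y z + 1)) - (\<alpha> + 1 / 2)) * exp (2 * z) \<le> 0"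
      using \<alpha> by (intro mult_nonpos_nonneg) auto
    have "((\<lambda>x. - p x * exp (2 * x)) has_real_derivative
        (- 2 * (p z * (Y z + 1)) - (\<alpha> + 1 / 2)) * exp (2 * z)) (at z)"
      by (auto intro!: derivative_eq_intros dp simp: algebra_simps)
    with le show "\<exists>y. ((\<lambda>x. - p x * exp (2 * x)) has_real_derivative y) (at z) \<and> y \<le> 0" by blast
  qed
  \<comment> \<open>For \<open>t \<ge> R\<close> one has
    \<open>\<rho> * exp (2 t) \<ge> \<rho> * t\<^sup>2 \<ge> 2 t\<close>, which exceeds the term
    \<open>t / 2\<close> in \<open>Y' (- t)\<close> by at least 1.\<close>
  define R where "R = max (max 1 (2 / \<rho>)) (- S)"
  have steep: "Y' (- t) \<le> - 1" if t: "t \<ge> R" for t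
  proof -
    have t1: "t \<ge> 1" "t \<ge> 2 / \<rho>" "- t \<le> S" using t by (auto simp: R_def)
    then have "\<rho> * t \<ge> 2" using \<rho> by (simp add: field_simps)
    then have "\<rho> * t * t \<ge> 2 * t" using t1 by (intro mult_right_mono) auto
    moreover have "t * t \<le> exp t * exp t"
      using exp_ge_add_one_self[of t] t1 by (intro mult_mono) linarith+
    then have "\<rho> * (t * t) \<le> \<rho> * (exp t * exp t)" using \<rho> by (intro mult_left_mono) auto
    moreover have "- p (- t) \<ge> \<rho> * (exp t * exp t)"
    proof -
      have "- p (- t) = - p (- t) * exp (2 * (- t)) * (exp t * exp t)"
        by (simp flip: exp_add)
      then show ?thesis using grow[OF t1(3)] by (metis exp_gt_zero less_imp_le mult_pos_pos mult_right_mono)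
    qed
    moreover have "Y' (- t) = p (- t) - (Y (- t))\<^sup>2 + t / 2" by (simp add: p_def)
    moreover have "(Y (- t))\<^sup>2 \<ge> 0" by simp
    ultimately show ?thesis using t1(1) unfolding mult.assoc by linarith
  qed
  \<comment> \<open>A step of length \<open>h\<close> to the left raises \<open>Y\<close> by at
    least \<open>h\<close>, which suffices to lift it to 1.\<close>
  define h where "h = \<bar>Y (- R)\<bar> + 1"
  have h: "h > 0" by (simp add: h_def)
  have "\<exists>z>- R - h. z < - R \<and> Y (- R) - Y (- R - h) = (- R - (- R - h)) * Y' z"
    by (rule MVT2) (use h Y in auto)
  then obtain z where z: "z < - R" "Y (- R) - Y (- R - h) = h * Y' z" by auto
  have "h * Y' z \<le> h * (- 1)" using steep[of "- z"] z h by (intro mult_left_mono) auto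
  then have "Y (- R - h) \<ge> 1" using z by (simp add: h_def)
  moreover have "Y (- R - h) \<le> - 1" using left h by (simp add: R_def S_def)
  ultimately show False by simp
qed

text \<open>Every zero is crossed upwards, so there is only one. For \<open>s < 0\<close> this
  follows from \<open>p\<close>; for \<open>s \<ge> 0\<close> a zero with \<open>Y' \<le> 0\<close>
  would start a convex, unbounded growth of \<open>- Y\<close>.\<close>

lemma changes_sign_exactly_once_of_riccati_defect_nonneg:
  fixes Y Y' :: "real \<Rightarrow> real"
  assumes Y: "\<And>s. (Y has_real_derivative Y' s) (at s)"
    and Y': "\<And>s. (Y' has_real_derivative s * Y s + 2 * Y s ^ 3 + \<alpha>) (at s)"
    and \<alpha>: "\<alpha> < 0"
    and p: "\<And>s. Y' s + (Y s)\<^sup>2 + s / 2 \<ge> 0"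
    and bound: "\<And>s. s \<ge> 0 \<Longrightarrow> \<bar>Y s\<bar> \<le> M"
    and "x < y" "Y x < 0" "Y y > 0"
  shows "changes_sign_exactly_once Y"
proof -
  have up: "Y' s > 0" if Ys: "Y s = 0" for s
  proof (cases "s < 0")
    case True
    then show ?thesis using p[of s] Ys by simp
  next
    case False
    then have s: "s \<ge> 0" by simp
    define D where "D = (\<lambda>s. - Y s)"
    define D' where "D' = (\<lambda>s. - Y' s)"
    define D'' where "D'' = (\<lambda>s. - (s * Y s + 2 * Y s ^ 3 + \<alpha>))"
    have D: "(D has_real_derivative D' s) (at s)" "(D' has_real_derivative D'' s) (at s)" for s
      unfolding D_def D'_def D''_def by (intro DERIV_minus Y Y')+
    show ?thesis
    proof (rule ccontr)
      assume "\<not> Y' s > 0"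
      then have D's: "D' s \<ge> 0" by (simp add: D'_def)
      \<comment> \<open>Both \<open>D\<close> and \<open>D'\<close> may vanish at \<open>s\<close>;
        the positive second derivative gives a point slightly to the right where
        \<open>D > 0\<close> and \<open>D' \<ge> 0\<close>.\<close>
      have "D'' s > 0" using Ys \<alpha> by (simp add: D''_def)
      then obtain d where d: "d > 0" "\<And>h. 0 < h \<Longrightarrow> h < d \<Longrightarrow> D' s < D' (s + h)"
        using DERIV_pos_inc_right[OF D(2)] by blast
      have "\<exists>z>s. z < s + d / 2 \<and> D (s + d / 2) - D s = (s + d / 2 - s) * D' z"
        by (rule MVT2) (use d D in auto)
      then obtain z where z: "z > s" "z < s + d / 2" "D (s + d / 2) - D s = d / 2 * D' z" by auto
      have "D' z > 0" using d(2)[of "z - s"] z D's d(1) by auto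
      then have "d / 2 * D' z > 0" using d(1) by simp
      then have pos: "D (s + d / 2) > 0" using z(3) Ys by (simp add: D_def)
      have nonneg: "D' (s + d / 2) \<ge> 0" using d(2)[of "d / 2"] d(1) D's by auto
      obtain t where "t \<ge> s + d / 2" "D t > M"
      proof (rule uniformly_convex_where_positive_unbounded[OF D _ _ pos nonneg, of "- \<alpha>" M])
        fix t assume t: "t \<ge> s + d / 2" "D t > 0"
        have "D'' t = t * D t + 2 * D t ^ 3 - \<alpha>" by (simp add: D''_def D_def)
        moreover have "t * D t \<ge> 0" "D t ^ 3 \<ge> 0" using t s d(1) by auto
        ultimately show "D'' t \<ge> - \<alpha>" by linarith
      qed (use \<alpha> in auto)
      then show False using bound[of t] s d(1) by (auto simp: D_def)
    qed
  qed
  have "continuous_on {x..y} Y"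
    by (rule DERIV_continuous_on[of _ _ Y']) (rule has_field_derivative_at_within[OF Y])
  then obtain z where z: "Y z = 0"
    using IVT'[of Y x 0 y] assms(6-8) by auto
  have "Y s > 0" if "s > z" for s
    by (rule no_down_crossing[of z s Y Y', OF Y that]) (use z up in auto)
  moreover have "Y s < 0" if "s < z" for s
  proof (rule ccontr)
    assume "\<not> Y s < 0"
    then have "Y z > 0" by (intro no_down_crossing[of s z Y Y', OF Y that]) (use up in auto)
    then show False using z by simp
  qed
  ultimately show ?thesis unfolding changes_sign_exactly_once_def by blast
qed

text \<open>Comparison with \<open>a / s\<close> for \<open>a\<close> near
  \<open>- \<alpha>\<close>: where the difference has the wrong sign, the linear term and
  \<open>\<alpha>\<close> leave a fixed positive gap, while \<open>(a / s)''\<close> tends to zero.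
  A bounded function that is uniformly convex where positive is eventually nonpositive.\<close>

lemma decaying_solution_asymptotics:
  fixes Y Y' :: "real \<Rightarrow> real"
  assumes Y: "\<And>s. (Y has_real_derivative Y' s) (at s)"
    and Y': "\<And>s. (Y' has_real_derivative s * Y s + 2 * Y s ^ 3 + \<alpha>) (at s)"
    and \<alpha>: "\<alpha> < 0"
    and decay: "\<And>s. s > 0 \<Longrightarrow> \<bar>Y s\<bar> \<le> c / s"
  shows "Y \<sim>[at_top] (\<lambda>s. \<bar>\<alpha>\<bar> / s)"
proof (rule asymp_equivI')
  have c: "c \<ge> 0" using decay[of 1] by simp
  have dinv: "((\<lambda>s. a / s) has_real_derivative - a / s\<^sup>2) (at s)"
    "((\<lambda>s. - a / s\<^sup>2) has_real_derivative 2 * a / s ^ 3) (at s)" if "s > 0" for s a :: real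
    using that by (auto intro!: derivative_eq_intros simp: field_simps eval_nat_numeral)
  have small: "\<forall>\<^sub>F s in at_top. A / s ^ 3 < \<delta>" if "\<delta> > 0" for A \<delta> :: real
  proof -
    have "((\<lambda>s. A / s ^ 3) \<longlongrightarrow> 0) at_top"
      by (intro tendsto_divide_0[OF tendsto_const] filterlim_at_top_imp_at_infinity
          filterlim_pow_at_top filterlim_ident) auto
    then show ?thesis using order_tendstoD(2) that by blast
  qed
  have upper: "\<forall>\<^sub>F s in at_top. Y s - a / s \<le> 0" if a: "a > - \<alpha>" for a
  proof -
    \<comment> \<open>Half of the gap \<open>a + \<alpha>\<close>; the other half pays for
      \<open>2 * a / s ^ 3\<close>.\<close>
    define \<delta> where "\<delta> = (a + \<alpha>) / 2"
    have \<delta>: "\<delta> > 0" using a by (simp add: \<delta>_def)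
    obtain S where S: "S \<ge> 1" "\<And>s. s \<ge> S \<Longrightarrow> 2 * a / s ^ 3 < \<delta>"
      using eventually_conj[OF small[OF \<delta>, of "2 * a"] eventually_ge_at_top[of 1]]
      unfolding eventually_at_top_linorder by (metis max.bounded_iff max.cobounded1 order_refl)
    show ?thesis
    proof (rule uniformly_convex_where_positive_eventually_nonpos[of S _ "\<lambda>s. Y' s - - a / s\<^sup>2"
          "\<lambda>s. (s * Y s + 2 * Y s ^ 3 + \<alpha>) - 2 * a / s ^ 3" \<delta> c])
      fix s assume s: "s \<ge> S"
      then have s0: "s > 0" "s \<ge> 1" using S by auto
      show "((\<lambda>s. Y s - a / s) has_real_derivative Y' s - - a / s\<^sup>2) (at s)"
        "((\<lambda>s. Y' s - - a / s\<^sup>2) has_real_derivative (s * Y s + 2 * Y s ^ 3 + \<alpha>) - 2 * a / s ^ 3) (at s)"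
        by (intro DERIV_diff Y Y' dinv s0)+
      have a0: "a / s \<ge> 0" using a \<alpha> s0 by simp
      have "c / s \<le> c" using c s0 by (simp add: divide_le_eq mult_le_cancel_left1)
      then show "Y s - a / s \<le> c" using decay[OF s0(1)] a0 by linarith
      assume pos: "0 < Y s - a / s"
      then have "s * Y s > a" using s0 by (simp add: field_simps)
      moreover have "Y s ^ 3 \<ge> 0" using pos a0 by simp
      ultimately show "\<delta> \<le> (s * Y s + 2 * Y s ^ 3 + \<alpha>) - 2 * a / s ^ 3"
        using S(2)[OF s] unfolding \<delta>_def by argo
    qed (rule \<delta>)
  qed
  have lower: "\<forall>\<^sub>F s in at_top. a / s - Y s \<le> 0" if a: "0 \<le> a" "a < - \<alpha>" for a
  proof -
    \<comment> \<open>Here the cubic term has the unfavourable sign, and half of the gap pays for it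
      through the decay \<open>\<bar>Y s\<bar> \<le> c / s\<close>.\<close>
    define \<delta> where "\<delta> = (- \<alpha> - a) / 2"
    have \<delta>: "\<delta> > 0" using a by (simp add: \<delta>_def)
    obtain S where S: "S \<ge> 1" "\<And>s. s \<ge> S \<Longrightarrow> 2 * c ^ 3 / s ^ 3 < \<delta>"
      using eventually_conj[OF small[OF \<delta>, of "2 * c ^ 3"] eventually_ge_at_top[of 1]]
      unfolding eventually_at_top_linorder by (metis max.bounded_iff max.cobounded1 order_refl)
    show ?thesis
    proof (rule uniformly_convex_where_positive_eventually_nonpos[of S _ "\<lambda>s. - a / s\<^sup>2 - Y' s"
          "\<lambda>s. 2 * a / s ^ 3 - (s * Y s + 2 * Y s ^ 3 + \<alpha>)" \<delta> "a + c"])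
      fix s assume s: "s \<ge> S"
      then have s0: "s > 0" "s \<ge> 1" using S by auto
      show "((\<lambda>s. a / s - Y s) has_real_derivative - a / s\<^sup>2 - Y' s) (at s)"
        "((\<lambda>s. - a / s\<^sup>2 - Y' s) has_real_derivative 2 * a / s ^ 3 - (s * Y s + 2 * Y s ^ 3 + \<alpha>)) (at s)"
        by (intro DERIV_diff Y Y' dinv s0)+
      have "c / s \<le> c" "a / s \<le> a" using c a s0 by (auto simp: divide_le_eq mult_le_cancel_left1)
      then show "a / s - Y s \<le> a + c" using decay[OF s0(1)] by linarith
      assume "0 < a / s - Y s"
      then have "s * Y s < a" using s0 by (simp add: field_simps)
      moreover have "Y s ^ 3 \<le> \<bar>Y s\<bar> ^ 3" by (metis abs_ge_self power_abs)
      moreover have "\<bar>Y s\<bar> ^ 3 \<le> (c / s) ^ 3" using decay[OF s0(1)] by (intro power_mono) auto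
      moreover have "2 * (c / s) ^ 3 < \<delta>" using S(2)[OF s] by (simp add: power_divide)
      moreover have "2 * a / s ^ 3 \<ge> 0" using a s0 by simp
      ultimately show "\<delta> \<le> 2 * a / s ^ 3 - (s * Y s + 2 * Y s ^ 3 + \<alpha>)"
        unfolding \<delta>_def by argo
    qed (rule \<delta>)
  qed
  show "((\<lambda>s. Y s / (\<bar>\<alpha>\<bar> / s)) \<longlongrightarrow> 1) at_top"
  proof (rule tendstoI)
    fix e :: real assume e: "e > 0"
    \<comment> \<open>The cap at 1 keeps the lower comparison constant
      \<open>(1 - \<epsilon>) * (- \<alpha>)\<close> nonnegative.\<close>
    define \<epsilon> where "\<epsilon> = min (e / 2) 1"
    have \<epsilon>: "0 < \<epsilon>" "\<epsilon> \<le> 1" "\<epsilon> < e" using e by (auto simp: \<epsilon>_def)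
    have 1: "- ((1 + \<epsilon>) * \<alpha>) > - \<alpha>" "0 \<le> - ((1 - \<epsilon>) * \<alpha>)" "- ((1 - \<epsilon>) * \<alpha>) < - \<alpha>"
      using \<epsilon> \<alpha> by (auto simp: algebra_simps mult_pos_neg mult_le_0_iff mult_less_0_iff)
    show "\<forall>\<^sub>F s in at_top. dist (Y s / (\<bar>\<alpha>\<bar> / s)) 1 < e"
      using upper[OF 1(1)] lower[OF 1(2,3)] eventually_gt_at_top[of 0]
    proof eventually_elim
      case (elim s)
      define q where "q = Y s / (\<bar>\<alpha>\<bar> / s)"
      have Ys: "Y s = q * (- \<alpha>) / s" using elim \<alpha> by (simp add: q_def)
      have "q * (- \<alpha>) \<le> (1 + \<epsilon>) * (- \<alpha>)" "(1 - \<epsilon>) * (- \<alpha>) \<le> q * (- \<alpha>)"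
        using elim unfolding Ys by (simp_all add: field_simps)
      then have "q \<le> 1 + \<epsilon>" "1 - \<epsilon> \<le> q" using \<alpha> by (simp_all add: mult_le_cancel_right)
      then show ?case using \<epsilon> unfolding dist_real_def q_def[symmetric] by linarith
    qed
  qed
qed

theorem corollary1p1:
  fixes \<alpha> :: real
  assumes "\<alpha> \<in> {-1/2<..<0}"
  shows "\<exists>Y :: real \<Rightarrow> real.
           painleve2_solution \<alpha> Y \<and>
           changes_sign_exactly_once Y \<and>
           energy_minimizing \<alpha> Y \<and>
           (\<lambda>s. Y s - (- sqrt (- s / 2))) \<in> O[at_bot](\<lambda>s. 1 / s) \<and>
           Y \<sim>[at_top] (\<lambda>s. \<bar>\<alpha>\<bar> / s)"
proof -
  have \<alpha>: "- 1 / 2 < \<alpha>" "\<alpha> < 0" using assms by auto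
  obtain Y Y' s\<^sub>0 M where Y: "\<And>s. (Y has_real_derivative Y' s) (at s)"
    and Y': "\<And>s. (Y' has_real_derivative s * Y s + 2 * Y s ^ 3 + \<alpha>) (at s)"
    and bound: "\<And>s. s \<ge> 0 \<Longrightarrow> \<bar>Y s\<bar> \<le> 1" and decay: "\<And>s. s > 0 \<Longrightarrow> \<bar>Y s\<bar> \<le> 2 / s"
    and "s\<^sub>0 < 0" and left: "\<And>s. s \<le> s\<^sub>0 \<Longrightarrow> \<bar>Y s + sqrt (- s / 2)\<bar> \<le> M / (- s)"
    using connecting_solution_exists[OF \<alpha>] by blast
  have "deriv Y = Y'" by (intro ext DERIV_imp_deriv Y)
  moreover have "deriv Y' s = s * Y s + 2 * Y s ^ 3 + \<alpha>" for s by (intro DERIV_imp_deriv Y')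
  ultimately have sol: "painleve2_solution \<alpha> Y"
    unfolding painleve2_solution_def using Y Y' by (auto simp: real_differentiable_def)
  have asymp_right: "Y \<sim>[at_top] (\<lambda>s. \<bar>\<alpha>\<bar> / s)"
    by (rule decaying_solution_asymptotics[OF Y Y' \<alpha>(2) decay])
  \<comment> \<open>Left of this point \<open>sqrt (- s / 2) \<ge> 1 + \<bar>M\<bar>\<close>, while
    the error \<open>M / (- s)\<close> is at most \<open>\<bar>M\<bar>\<close>; hence
    \<open>Y \<le> - 1\<close>.\<close>
  define s\<^sub>1 where "s\<^sub>1 = min s\<^sub>0 (- 2 * (1 + \<bar>M\<bar>)\<^sup>2)"
  have far_left: "Y s \<le> - 1" if s: "s \<le> s\<^sub>1" for s
  proof -
    have s': "s \<le> s\<^sub>0" "(1 + \<bar>M\<bar>)\<^sup>2 \<le> - s / 2" using s by (auto simp: s\<^sub>1_def)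
    have "1 \<le> (1 + \<bar>M\<bar>)\<^sup>2" by (intro one_le_power) auto
    then have "- s \<ge> 1" using s'(2) by linarith
    then have "M / (- s) \<le> \<bar>M\<bar> / 1" by (intro frac_le) auto
    moreover have "1 + \<bar>M\<bar> \<le> sqrt (- s / 2)" using s'(2) by (rule real_le_rsqrt)
    ultimately show ?thesis using left[OF s'(1)] by linarith
  qed
  have p: "Y' s + (Y s)\<^sup>2 + s / 2 \<ge> 0" for s
    by (rule riccati_defect_nonneg[OF Y Y' \<alpha>(1) far_left])
  have "\<forall>\<^sub>F s in at_top. Y s > 0"
  proof -
    have "\<forall>\<^sub>F s in at_top. Y s / (\<bar>\<alpha>\<bar> / s) > 0"
    proof (rule order_tendstoD(1))
      \<comment> \<open>Asymptotic equivalence assigns the quotient 1 where both functions vanish;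
        eventual nonvanishing of the comparison function gives convergence of the plain
        quotient.\<close>
      have "\<forall>\<^sub>F s in at_top. \<bar>\<alpha>\<bar> / s \<noteq> 0"
        using eventually_gt_at_top[of 0] by eventually_elim (use \<alpha> in auto)
      then have "\<forall>\<^sub>F s in at_top. Y s \<noteq> 0 \<or> \<bar>\<alpha>\<bar> / s \<noteq> 0" by eventually_elim auto
      then show "((\<lambda>s. Y s / (\<bar>\<alpha>\<bar> / s)) \<longlongrightarrow> 1) at_top"
        using asymp_equivD_strong[OF asymp_right] by simp
    qed simp
    then show ?thesis using eventually_gt_at_top[of 0]
      by eventually_elim (use \<alpha> in \<open>auto simp: mult_less_0_iff zero_less_mult_iff divide_less_0_iff\<close>)
  qed
  then obtain t where t: "t > s\<^sub>1" "Y t > 0"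
    using eventually_conj[OF _ eventually_gt_at_top[of s\<^sub>1]] eventually_happens[of _ "at_top :: real filter"]
    by (metis (no_types, lifting) trivial_limit_at_top_linorder)
  have "changes_sign_exactly_once Y"
    by (rule changes_sign_exactly_once_of_riccati_defect_nonneg[OF Y Y' \<alpha>(2) p bound t(1) _ t(2)])
      (use far_left[of s\<^sub>1] in auto)
  moreover have "(\<lambda>s. Y s - (- sqrt (- s / 2))) \<in> O[at_bot](\<lambda>s. 1 / s)"
  proof (rule bigoI[of _ M])
    show "\<forall>\<^sub>F s in at_bot. norm (Y s - - sqrt (- s / 2)) \<le> M * norm (1 / s)"
      using eventually_le_at_bot[of s\<^sub>0]
    proof eventually_elim
      case (elim s)
      then show ?case using left[OF elim] \<open>s\<^sub>0 < 0\<close> by simp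
    qed
  qed
  moreover have "energy_minimizing \<alpha> Y"
    by (rule energy_minimizing_of_riccati_defect_nonneg[OF Y Y' p])
  ultimately show ?thesis using sol asymp_right by blast
qed

end
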